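(* Let $n>6$ and let $G_n$ be a connected bicyclic graph of order $n$ (i.e., a connected simple graph with $n$ vertices and $n+1$ edges) that is not isomorphic to $B_n$. Then $Sz^*(G_n)<Sz^*(B_n)$.
   Context: All graphs are finite, simple and undirected. For a connected graph $G=(V,E)$ and an edge $e=uv\in E$, let $N_u(e)=\{w\in V: d(u,w)<d(v,w)\}$, $N_v(e)=\{w\in V: d(v,w)<d(u,w)\}$, $N_0(e)=\{w\in V: d(u,w)=d(v,w)\}$, where $d$ is the graph distance, and let $n_u(e),n_v(e),n_0(e)$ be their cardinalities. The revised Szeged index is $Sz^*(G)=\sum_{e=uv\in E}\left(n_u(e)+\frac{n_0(e)}{2}\right)\left(n_v(e)+\frac{n_0(e)}{2}\right)$. $B_n$ denotes the graph obtained from the cycle $C_{n-1}$ by duplicating a single vertex, i.e., adding a new vertex adjacent exactly to the two neighbours of a chosen vertex of $C_{n-1}$. *)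

theory Defs
  imports "Graph_Theory.Graph_Theory"
begin

text \<open>Finite simple undirected graphs are the \<^emph>\<open>pair graphs\<close> of the library: finite vertex set,
  no loops, and every edge \<open>uv\<close> present as the two arcs \<open>(u, v)\<close> and \<open>(v, u)\<close>.\<close>

text \<open>The undirected edges, as two-element sets; each is counted once although it has two arcs.\<close>

definition uedges :: "'a pair_pre_digraph \<Rightarrow> 'a set set" where
  "uedges G = {{u, v} |u v. (u, v) \<in> parcs G}"

definition gdist :: "'a pair_pre_digraph \<Rightarrow> 'a \<Rightarrow> 'a \<Rightarrow> ereal" where
  "gdist G u v = wf_digraph.\<mu> (with_proj G) (\<lambda>_. 1) u v"

definition closer :: "'a pair_pre_digraph \<Rightarrow> 'a \<Rightarrow> 'a set \<Rightarrow> 'a set" where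
  "closer G u e = {w \<in> pverts G. \<forall>v \<in> e - {u}. gdist G u w < gdist G v w}"

definition equidistant :: "'a pair_pre_digraph \<Rightarrow> 'a set \<Rightarrow> 'a set" where
  "equidistant G e = {w \<in> pverts G. \<forall>u \<in> e. \<forall>v \<in> e. gdist G u w = gdist G v w}"

text \<open>For an edge \<open>e = uv\<close> the product has exactly the two factors belonging to \<open>u\<close> and \<open>v\<close>;
  see \<open>szeged_term_edge\<close> below.\<close>

definition revised_szeged :: "'a pair_pre_digraph \<Rightarrow> real" where
  "revised_szeged G =
     (\<Sum>e \<in> uedges G. \<Prod>u \<in> e. real (card (closer G u e)) + real (card (equidistant G e)) / 2)"

lemma closer_edge:
  assumes "u \<noteq> v"
  shows "closer G u {u, v} = {w \<in> pverts G. gdist G u w < gdist G v w}"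
    and "closer G v {u, v} = {w \<in> pverts G. gdist G v w < gdist G u w}"
  using assms by (auto simp: closer_def)

lemma equidistant_edge:
  "equidistant G {u, v} = {w \<in> pverts G. gdist G u w = gdist G v w}"
  by (auto simp: equidistant_def)

lemma szeged_term_edge:
  assumes "u \<noteq> v"
  shows "(\<Prod>x \<in> {u, v}. real (card (closer G x {u, v})) + real (card (equidistant G {u, v})) / 2) =
    (real (card {w \<in> pverts G. gdist G u w < gdist G v w})
       + real (card {w \<in> pverts G. gdist G u w = gdist G v w}) / 2) *
    (real (card {w \<in> pverts G. gdist G v w < gdist G u w})
       + real (card {w \<in> pverts G. gdist G u w = gdist G v w}) / 2)"
  using assms by (simp add: closer_edge equidistant_edge)

definition cycle_graph :: "nat \<Rightarrow> nat pair_pre_digraph" where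
  "cycle_graph m =
     \<lparr> pverts = {0..<m},
       parcs = {(i, j). i < m \<and> j < m \<and> (j = Suc i mod m \<or> i = Suc j mod m)} \<rparr>"

text \<open>\<open>duplicate_vertex G v w\<close> is meant for a fresh vertex \<open>w\<close>; \<open>w\<close> is not made adjacent to \<open>v\<close>.\<close>

definition duplicate_vertex :: "'a pair_pre_digraph \<Rightarrow> 'a \<Rightarrow> 'a \<Rightarrow> 'a pair_pre_digraph" where
  "duplicate_vertex G v w =
     \<lparr> pverts = insert w (pverts G),
       parcs = parcs G \<union> {(w, x) |x. (v, x) \<in> parcs G} \<union> {(x, w) |x. (x, v) \<in> parcs G} \<rparr>"

text \<open>Meaningful for \<open>n \<ge> 4\<close>. The cycle is vertex-transitive, so duplicating vertex \<open>0\<close> is no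
  restriction up to isomorphism.\<close>

definition B_graph :: "nat \<Rightarrow> nat pair_pre_digraph" where
  "B_graph n = duplicate_vertex (cycle_graph (n - 1)) 0 (n - 1)"

lemma pair_graph_B_graph:
  assumes "n \<ge> 4"
  shows "pair_graph (B_graph n)"
proof
  have lt: "Suc i mod (n - 1) < n - 1" for i
    using assms by (intro mod_less_divisor) simp
  have ne: "Suc i mod (n - 1) \<noteq> i" if "i < n - 1" for i
    using that assms by (cases "Suc i = n - 1") auto
  have sub: "parcs (B_graph n) \<subseteq> pverts (B_graph n) \<times> pverts (B_graph n)"
    using assms lt by (auto simp: B_graph_def duplicate_vertex_def cycle_graph_def)
  show fin: "finite (pverts (B_graph n))"
    by (simp add: B_graph_def duplicate_vertex_def cycle_graph_def)
  show "finite (parcs (B_graph n))"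
    by (rule finite_subset[OF sub]) (simp add: fin)
  show "fst e \<in> pverts (B_graph n)" if "e \<in> parcs (B_graph n)" for e
    using that sub by auto
  show "snd e \<in> pverts (B_graph n)" if "e \<in> parcs (B_graph n)" for e
    using that sub by auto
  show "fst e \<noteq> snd e" if "e \<in> parcs (B_graph n)" for e
  proof -
    obtain i j where e: "e = (i, j)" by (cases e)
    show ?thesis
      using that ne[of i] ne[of j] unfolding e
      by (auto simp: B_graph_def duplicate_vertex_def cycle_graph_def)
  qed
  show "symmetric (with_proj (B_graph n))"
    unfolding symmetric_def with_proj_simps
    by (rule symI) (auto simp: B_graph_def duplicate_vertex_def cycle_graph_def)
qed

lemma card_pverts_B_graph:
  assumes "n \<ge> 4"
  shows "card (pverts (B_graph n)) = n"
  using assms by (simp add: B_graph_def duplicate_vertex_def cycle_graph_def)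

end

theory Submission
  imports Defs
begin

text \<open>Let \<open>D v\<close> be the sum of the distances from \<open>v\<close>. For an edge \<open>uv\<close> the two factors of its term in
  \<open>Sz\<^sup>*\<close> add up to \<open>n\<close> and differ by \<open>D v - D u\<close>, so \<open>4 Sz\<^sup>* = (n + 1) n\<^sup>2 - S\<close> where \<open>S\<close> is the sum of
  \<open>(D u - D v)\<^sup>2\<close> over all edges. In \<open>B\<^sub>n\<close> all differences are at most 1, hence \<open>S \<le> n + 1\<close>; for every other
  bicyclic graph \<open>S > n + 1\<close>.

  A pendant edge alone contributes \<open>(n - 2)\<^sup>2\<close>. If all degrees are at least 2, then at least \<open>n - 2\<close>
  vertices have degree 2, and each of them can be charged with an edge of its own on which \<open>D\<close> changes:
  a cut vertex of degree 2 has a neighbour with larger \<open>D\<close>, while any other one lies on an isometric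
  cycle and has a neighbour with smaller \<open>D\<close> there. So at most three edges have difference 0, and it
  remains to find two edges with difference at least 2. On an isometric cycle \<open>C\<close> the vertices of
  \<open>C\<close> cancel in \<open>D u - D v\<close>; the rest \<open>G - C\<close> is connected and joined to \<open>C\<close> by at most two edges, and
  two steep edges are found where it is attached, unless \<open>G\<close> is \<open>B\<^sub>n\<close>.\<close>

section \<open>Distances along a cycle, computed modulo its length\<close>

text \<open>The distance on a cycle of length \<open>m\<close> between two positions that differ by
  \<open>k\<close>. Residues make it meaningful for all integers, so positions need no
  range.\<close>

definition cyc :: "int \<Rightarrow> int \<Rightarrow> int" where
  "cyc m k = min (k mod m) ((- k) mod m)"

lemma cyc_abs:
  assumes "\<bar>k\<bar> < m"
  shows "cyc m k = min \<bar>k\<bar> (m - \<bar>k\<bar>)"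
proof (cases "k = 0")
  case False
  have "k mod m = (if k < 0 then k + m else k)"
    using assms mod_add_self2[of k m] by (auto simp del: mod_add_self2)
  moreover have "(- k) mod m = (if k < 0 then - k else m - k)"
    using assms False mod_add_self2[of "- k" m] mod_pos_pos_trivial[of "- k + m" m]
    by (auto simp del: mod_add_self2)
  ultimately show ?thesis
    by (auto simp: cyc_def)
qed (use assms in \<open>simp add: cyc_def\<close>)

lemma cyc_mod: "cyc m (k mod m) = cyc m k"
  by (simp add: cyc_def mod_minus_eq)

lemma cyc_uminus: "cyc m (- k) = cyc m k"
  by (simp add: cyc_def min.commute)

lemma cyc_diff_commute: "cyc m (i - j) = cyc m (j - i)"
  by (metis cyc_uminus minus_diff_eq)

lemma cyc_eq_0_iff:
  assumes "m > 0"
  shows "cyc m k = 0 \<longleftrightarrow> m dvd k"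
proof -
  have "cyc m k = cyc m (k mod m)" by (simp add: cyc_mod)
  also have "\<dots> = min (k mod m) (m - k mod m)"
    using assms by (subst cyc_abs) auto
  finally show ?thesis
    using pos_mod_bound[OF assms, of k] pos_mod_sign[OF assms, of k]
    by (simp add: dvd_eq_mod_eq_0 min_def)
qed

lemma cyc_step_abs:
  assumes "m > 0"
  shows "\<bar>cyc m (k + 1) - cyc m k\<bar> \<le> 1"
proof -
  define r where "r = k mod m"
  have r: "0 \<le> r" "r < m" using assms by (auto simp: r_def)
  have k: "cyc m k = min r (m - r)"
    using r cyc_abs[of r m] by (simp add: r_def cyc_mod)
  have "cyc m (k + 1) = cyc m (r + 1)"
    unfolding r_def by (metis cyc_mod mod_add_left_eq)
  also have "\<dots> = (if r + 1 = m then 0 else min (r + 1) (m - (r + 1)))"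
    using r cyc_abs[of "r + 1" m] assms cyc_eq_0_iff[of m m] by auto
  finally show ?thesis using k r by auto
qed

text \<open>By the one-step bound, moving on by \<open>k mod m\<close> positions raises
  \<open>cyc\<close> by at most that number; reflection gives the same for moving back by
  \<open>(- k) mod m\<close>. The smaller of the two numbers is \<open>cyc m k\<close>.\<close>

lemma cyc_triangle:
  assumes "m > 0"
  shows "cyc m (j + k) \<le> cyc m j + cyc m k"
proof -
  have nat: "\<bar>cyc m (j + int i) - cyc m j\<bar> \<le> int i" for i j
  proof (induction i)
    case (Suc i)
    then show ?case using cyc_step_abs[OF assms, of "j + int i"] by (simp add: algebra_simps)
  qed simp
  have pos: "cyc m (j + k) \<le> cyc m j + k mod m" for j k
  proof -
    have "cyc m (j + k) = cyc m (j + k mod m)" by (metis cyc_mod mod_add_right_eq)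
    then show ?thesis using nat[of j "nat (k mod m)"] assms by simp
  qed
  have "cyc m (j + k) = cyc m (- j + - k)" by (metis cyc_uminus minus_add_distrib)
  also have "\<dots> \<le> cyc m j + (- k) mod m" using pos[of "- j" "- k"] by (simp add: cyc_uminus)
  finally show ?thesis using pos[of j k] by (simp add: cyc_def[of m k])
qed

section \<open>Symmetric relations and finite maxima\<close>

text \<open>Opposite pairs can be removed together. In \<open>card_arcs_touching\<close> this parity
  improves an odd lower bound by one.\<close>

lemma even_card_sym:
  assumes "finite T" "\<And>u v. (u, v) \<in> T \<Longrightarrow> (v, u) \<in> T" "\<And>v. (v, v) \<notin> T"
  shows "even (card T)"
  using assms
proof (induction T rule: finite_psubset_induct)
  case (psubset T)
  show ?case
  proof (cases "T = {}")
    case False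
    then obtain u v where uv: "(u, v) \<in> T" by auto
    then have vu: "(v, u) \<in> T" "u \<noteq> v" using psubset.prems by auto
    have "even (card (T - {(u, v), (v, u)}))"
      using psubset.prems uv by (intro psubset.IH) auto
    moreover have "card T = card (T - {(u, v), (v, u)}) + 2"
      using uv vu psubset.hyps card_Diff_subset[of "{(u, v), (v, u)}" T] card_mono[of T "{(u, v), (v, u)}"]
      by auto
    ultimately show ?thesis by simp
  qed simp
qed

lemma relpow_converse_sym:
  assumes "\<And>u v. (u, v) \<in> B \<Longrightarrow> (v, u) \<in> B" "(u, v) \<in> B ^^ k"
  shows "(v, u) \<in> B ^^ k"
  using assms(2)
proof (induction k arbitrary: v)
  case (Suc k)
  then obtain z where "(u, z) \<in> B ^^ k" "(z, v) \<in> B" by auto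
  then show ?case using Suc.IH assms(1) relpow_Suc_I2 by metis
qed simp

lemma rtrancl_converse_sym:
  assumes "\<And>u v. (u, v) \<in> B \<Longrightarrow> (v, u) \<in> B" "(u, v) \<in> B\<^sup>*"
  shows "(v, u) \<in> B\<^sup>*"
  using relpow_converse_sym[OF assms(1)] assms(2) unfolding rtrancl_power by blast

lemma finite_arg_max_int:
  fixes f :: "'a \<Rightarrow> int"
  assumes "finite S" "S \<noteq> {}"
  obtains x where "x \<in> S" "\<And>y. y \<in> S \<Longrightarrow> f y \<le> f x"
proof -
  have "Max (f ` S) \<in> f ` S" using assms by (intro Max_in) auto
  then obtain x where "x \<in> S" "f x = Max (f ` S)" by (metis imageE)
  then show ?thesis using that assms(1) by simp
qed

section \<open>Distances and isometric cycles\<close>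

locale connected_graph =
  fixes V :: "'a set" and A :: "('a \<times> 'a) set"
  assumes finite_V: "finite V"
    and A_subset: "A \<subseteq> V \<times> V"
    and A_sym: "(u, v) \<in> A \<Longrightarrow> (v, u) \<in> A"
    and A_irrefl: "(v, v) \<notin> A"
    and A_conn: "u \<in> V \<Longrightarrow> v \<in> V \<Longrightarrow> (u, v) \<in> A\<^sup>*"
begin

text \<open>An integer rather than a natural number, so that distances can be subtracted freely;
  \<open>gdist_eq\<close> identifies it with \<open>gdist\<close>.\<close>

definition d :: "'a \<Rightarrow> 'a \<Rightarrow> int" where
  "d u v = int (LEAST k. (u, v) \<in> A ^^ k)"

definition D :: "'a \<Rightarrow> int" where
  "D v = (\<Sum>w\<in>V. d v w)"

lemma finite_A: "finite A"
  using A_subset finite_V by (meson finite_SigmaI finite_subset)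

lemma A_V: "(u, v) \<in> A \<Longrightarrow> u \<in> V \<and> v \<in> V"
  using A_subset by auto

lemma d_nonneg: "0 \<le> d u v"
  by (simp add: d_def)

lemma d_le_relpow: "(u, v) \<in> A ^^ k \<Longrightarrow> d u v \<le> int k"
  by (simp add: d_def Least_le)

lemma relpow_d:
  assumes "u \<in> V" "v \<in> V"
  shows "(u, v) \<in> A ^^ nat (d u v)"
  using A_conn[OF assms] LeastI_ex[of "\<lambda>k. (u, v) \<in> A ^^ k"]
  by (auto simp: d_def rtrancl_power)

lemma d_self [simp]: "d u u = 0"
  using d_le_relpow[of u u 0] d_nonneg[of u u] by simp

lemma d_eq_0_iff: "u \<in> V \<Longrightarrow> v \<in> V \<Longrightarrow> d u v = 0 \<longleftrightarrow> u = v"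
  using relpow_d[of u v] by auto

lemma d_commute: "u \<in> V \<Longrightarrow> v \<in> V \<Longrightarrow> d u v = d v u"
  using relpow_d[of u v] relpow_d[of v u] d_le_relpow[OF relpow_converse_sym[OF A_sym]] d_nonneg
  by (metis antisym nat_0_le)

lemma d_triangle:
  assumes "u \<in> V" "v \<in> V" "w \<in> V"
  shows "d u w \<le> d u v + d v w"
proof -
  have "(u, w) \<in> A ^^ (nat (d u v) + nat (d v w))"
    using relpow_d assms by (auto simp: relpow_add)
  then show ?thesis using d_le_relpow d_nonneg by fastforce
qed

lemma d_adj: 
  assumes "(u, v) \<in> A"
  shows "d u v = 1"
proof -
  have "d u v \<le> 1" using d_le_relpow[of u v 1] assms by simp
  moreover have "d u v \<noteq> 0" using assms A_V A_irrefl d_eq_0_iff by blast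
  ultimately show ?thesis using d_nonneg[of u v] by linarith
qed

lemma d_eq_1D: "u \<in> V \<Longrightarrow> v \<in> V \<Longrightarrow> d u v = 1 \<Longrightarrow> (u, v) \<in> A"
  using relpow_d[of u v] by simp

lemma d_adj_le: "(u, v) \<in> A \<Longrightarrow> w \<in> V \<Longrightarrow> d u w \<le> d v w + 1"
  using d_triangle[of u v w] d_adj A_V by fastforce

lemma d_closer:
  assumes "u \<in> V" "w \<in> V" "u \<noteq> w"
  obtains v where "(u, v) \<in> A" "d u w = d v w + 1"
proof -
  have "d u w > 0" using assms d_eq_0_iff d_nonneg by (metis less_le)
  then obtain k where k: "nat (d u w) = Suc k" by (metis Suc_pred' zero_less_nat_eq)
  obtain v where v: "(u, v) \<in> A" "(v, w) \<in> A ^^ k"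
    using relpow_d[OF assms(1,2)] unfolding k by (metis relpow_Suc_D2)
  have "d u w \<ge> d v w + 1" using d_le_relpow[OF v(2)] k by linarith
  then show ?thesis using d_adj_le[OF v(1) assms(2)] v that by force
qed

text \<open>Induction along a shortest walk. A suitable \<open>h\<close> certifies a lower bound on
  distances; this is how distances in \<open>B_graph\<close> are bounded from below.\<close>

lemma lipschitz_le_d:
  fixes h :: "'a \<Rightarrow> int"
  assumes h: "\<And>u v. (u, v) \<in> A \<Longrightarrow> h u \<le> h v + 1" and "u \<in> V" "v \<in> V"
  shows "h u \<le> h v + d u v"
proof -
  have "h u \<le> h v + int k" if "(u, v) \<in> A ^^ k" for k v
    using that by (induction k arbitrary: v) (fastforce dest: h)+
  from this[OF relpow_d[OF assms(2,3)]] show ?thesis using d_nonneg by simp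
qed

lemma A_boundary:
  assumes "K \<subseteq> V" "K \<noteq> {}" "K \<noteq> V"
  obtains u v where "u \<in> K" "v \<in> V - K" "(u, v) \<in> A"
proof -
  obtain a b where ab: "a \<in> K" "b \<in> V" "b \<notin> K" using assms by auto
  have "b \<in> K" if "\<forall>u\<in>K. \<forall>v\<in>V-K. (u, v) \<notin> A"
  proof -
    have "(a, b) \<in> A\<^sup>*" using ab assms A_conn by blast
    then show ?thesis
    proof (induction rule: rtrancl_induct)
      case base
      show ?case using ab by simp
    next
      case (step y z)
      then show ?case using A_V[of y z] that by blast
    qed
  qed
  then show ?thesis using ab that by blast
qed

lemma card_arcs_from:
  assumes "K \<subseteq> V"
  shows "card (A \<inter> K \<times> UNIV) = (\<Sum>v\<in>K. card (A `` {v}))"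
proof -
  have fK: "finite K" using assms finite_V finite_subset by blast
  have "A \<inter> K \<times> UNIV = (SIGMA v:K. A `` {v})" by auto
  moreover have "finite (A `` {v})" for v using finite_A by (simp add: finite_Image)
  ultimately show ?thesis using fK by simp
qed

lemma card_A: "card A = (\<Sum>v\<in>V. card (A `` {v}))"
proof -
  have "A \<inter> V \<times> UNIV = A" using A_subset by auto
  then show ?thesis using card_arcs_from[of V] by simp
qed

text \<open>Cycles are indexed by all integers, so that rotations and reflections are plain reindexings.
  Periodicity and adjacency of consecutive vertices follow from the distances.\<close>

definition isocycle :: "int \<Rightarrow> (int \<Rightarrow> 'a) \<Rightarrow> bool" where
  "isocycle m c \<longleftrightarrow> 3 \<le> m \<and> range c \<subseteq> V \<and> (\<forall>i j. d (c i) (c j) = cyc m (i - j))"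

lemma isocycle_shift: "isocycle m c \<Longrightarrow> isocycle m (\<lambda>i. c (i + s))"
  by (auto simp: isocycle_def)

lemma isocycle_reflect: "isocycle m c \<Longrightarrow> isocycle m (\<lambda>i. c (s - i))"
  by (auto simp: isocycle_def cyc_diff_commute)

lemma range_shift: "range (\<lambda>i::int. c (i + s)) = range c"
proof -
  have "c j \<in> range (\<lambda>i. c (i + s))" for j by (rule range_eqI[of _ _ "j - s"]) simp
  then show ?thesis by auto
qed

lemma range_reflect: "range (\<lambda>i::int. c (s - i)) = range c"
proof -
  have "c j \<in> range (\<lambda>i. c (s - i))" for j by (rule range_eqI[of _ _ "s - j"]) simp
  then show ?thesis by auto
qed

context
  fixes m c assumes iso: "isocycle m c"
begin

lemma iso_m: "3 \<le> m" and iso_V: "c i \<in> V" and iso_d: "d (c i) (c j) = cyc m (i - j)"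
  using iso by (auto simp: isocycle_def)

lemma iso_eq_iff: "c i = c j \<longleftrightarrow> m dvd i - j"
  using d_eq_0_iff[OF iso_V iso_V] cyc_eq_0_iff[of m] iso_m by (simp add: iso_d)

lemma iso_d_abs: "\<bar>i - j\<bar> < m \<Longrightarrow> d (c i) (c j) = min \<bar>i - j\<bar> (m - \<bar>i - j\<bar>)"
  by (simp add: iso_d cyc_abs)

lemma iso_neq: "i \<noteq> j \<Longrightarrow> \<bar>i - j\<bar> < m \<Longrightarrow> c i \<noteq> c j"
  using dvd_imp_le_int[of "i - j" m] iso_m by (auto simp: iso_eq_iff)

lemma iso_adj: "(c i, c (i + 1)) \<in> A" "(c i, c (i - 1)) \<in> A"
  using iso_m by (auto intro!: d_eq_1D simp: iso_V iso_d_abs)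

lemma iso_index:
  obtains k where "s \<le> k" "k < s + m" "c k = c i"
proof
  show "s \<le> s + (i - s) mod m" "s + (i - s) mod m < s + m" using iso_m by auto
  show "c (s + (i - s) mod m) = c i"
    unfolding iso_eq_iff by (simp add: algebra_simps mod_eq_dvd_iff[symmetric] mod_simps)
qed

lemma iso_bij: "bij_betw c {s..<s + m} (range c)"
  unfolding bij_betw_def
proof
  show "inj_on c {s..<s + m}"
  proof (rule inj_onI)
    fix i j assume ij: "i \<in> {s..<s + m}" "j \<in> {s..<s + m}" "c i = c j"
    then have "\<bar>i - j\<bar> < m" by auto
    then show "i = j" using iso_neq ij(3) by blast
  qed
  show "c ` {s..<s + m} = range c"
  proof
    show "range c \<subseteq> c ` {s..<s + m}"
    proof
      fix w assume "w \<in> range c"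
      then obtain i where "w = c i" by auto
      moreover obtain k where "s \<le> k" "k < s + m" "c k = c i" by (rule iso_index)
      ultimately show "w \<in> c ` {s..<s + m}" by (intro image_eqI[of _ _ k]) auto
    qed
  qed auto
qed

lemma iso_card: "int (card (range c)) = m"
  using bij_betw_same_card[OF iso_bij[of 0]] iso_m by simp

lemma iso_finite: "finite (range c)"
  using iso_bij[of 0] bij_betw_finite by blast

text \<open>The right-hand side is free of \<open>i\<close>: by rotation every vertex of the cycle
  has the same distance sum to the cycle, which therefore cancels in differences of
  \<open>D\<close>.\<close>

lemma iso_sum: "(\<Sum>w\<in>range c. d (c i) w) = (\<Sum>k\<in>{0..<m}. cyc m k)"
proof -
  have "(\<Sum>w\<in>range c. d (c i) w) = (\<Sum>k\<in>{i..<i + m}. d (c i) (c k))"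
    using sum.reindex_bij_betw[OF iso_bij[of i], of "d (c i)"] by simp
  also have "\<dots> = (\<Sum>k\<in>{0..<m}. cyc m k)"
    by (rule sum.reindex_bij_witness[of _ "\<lambda>k. i + k" "\<lambda>k. k - i"])
      (auto simp: iso_d cyc_diff_commute)
  finally show ?thesis .
qed

lemma iso_D_diff: "D (c i) - D (c j) = (\<Sum>w\<in>V - range c. d (c i) w - d (c j) w)"
proof -
  have "D (c k) = (\<Sum>w\<in>V - range c. d (c k) w) + (\<Sum>k\<in>{0..<m}. cyc m k)" for k
    unfolding D_def iso_sum[of k, symmetric]
    using iso_V finite_V by (intro sum.subset_diff) auto
  then show ?thesis by (simp add: sum_subtractf)
qed

lemma iso_nbrs: "A `` {c i} \<inter> range c = {c (i - 1), c (i + 1)}"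
proof
  show "A `` {c i} \<inter> range c \<subseteq> {c (i - 1), c (i + 1)}"
  proof
    fix w assume "w \<in> A `` {c i} \<inter> range c"
    then obtain j where j: "w = c j" "(c i, c j) \<in> A" by auto
    obtain k where k: "i - 1 \<le> k" "k < i - 1 + m" "c k = c j" by (rule iso_index)
    have "d (c i) (c k) = 1" using j k d_adj by simp
    moreover have "d (c i) (c k) = min \<bar>i - k\<bar> (m - \<bar>i - k\<bar>)"
      by (rule iso_d_abs) (use k iso_m in auto)
    ultimately have "k = i - 1 \<or> k = i + 1" using k by (auto simp: min_def split: if_splits)
    then show "w \<in> {c (i - 1), c (i + 1)}" using j k by auto
  qed
qed (use iso_adj in auto)

lemma iso_nbrs_card: "card (A `` {c i} \<inter> range c) = 2"
  using iso_neq[of "i - 1" "i + 1"] iso_m by (simp add: iso_nbrs)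

lemma iso_deg2: "card (A `` {c i}) = 2 \<Longrightarrow> A `` {c i} = {c (i - 1), c (i + 1)}"
  using iso_nbrs[of i] iso_nbrs_card[of i] finite_A
  by (metis card_subset_eq finite_Image inf_le1)

end

text \<open>Follow the closed walk forwards or backwards, whichever is shorter. This is the easy
  half of being isometric.\<close>

lemma closed_walk_d_le:
  assumes "m > 0" and per: "\<And>i. c (i mod m) = c i" and adj: "\<And>i::int. (c i, c (i + 1)) \<in> A"
  shows "d (c i) (c j) \<le> cyc m (i - j)"
proof -
  have V: "c i \<in> V" for i using adj A_V by blast
  have step: "d (c i) (c (i + int n)) \<le> int n" for i n
  proof (induction n)
    case (Suc n)
    have "d (c i) (c (i + int n + 1)) \<le> d (c i) (c (i + int n)) + d (c (i + int n)) (c (i + int n + 1))"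
      by (intro d_triangle V)
    also have "d (c (i + int n)) (c (i + int n + 1)) = 1" by (intro d_adj adj)
    finally show ?case using Suc by (simp add: algebra_simps)
  qed simp
  have mod: "d (c i) (c j) \<le> (j - i) mod m" for i j
  proof -
    have "c (i + (j - i) mod m) = c ((i + (j - i) mod m) mod m)" by (simp only: per)
    also have "\<dots> = c (j mod m)" by (simp add: mod_simps)
    finally have "c (i + (j - i) mod m) = c j" by (simp only: per)
    then show ?thesis using step[of i "nat ((j - i) mod m)"] assms(1) by simp
  qed
  show ?thesis using mod[of i j] mod[of j i] d_commute[OF V V, of i j] by (simp add: cyc_def)
qed

section \<open>Deleting a vertex: isometric cycles and cut vertices\<close>

definition del :: "'a \<Rightarrow> ('a \<times> 'a) set" where
  "del v = {(a, b). (a, b) \<in> A \<and> a \<noteq> v \<and> b \<noteq> v}"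

lemma del_sym: "(a, b) \<in> del v \<Longrightarrow> (b, a) \<in> del v"
  by (auto simp: del_def A_sym)

lemma del_relpow_sym: "(a, b) \<in> del v ^^ k \<Longrightarrow> (b, a) \<in> del v ^^ k"
  by (rule relpow_converse_sym[OF del_sym])

lemma del_rtrancl_sym: "(a, b) \<in> (del v)\<^sup>* \<Longrightarrow> (b, a) \<in> (del v)\<^sup>*"
  by (rule rtrancl_converse_sym[OF del_sym])

lemma relpow_avoid_or_via:
  "(p, q) \<in> A ^^ k \<Longrightarrow> (p, q) \<in> del v ^^ k \<or> (\<exists>i\<le>k. (p, v) \<in> A ^^ i \<and> (v, q) \<in> A ^^ (k - i))"
proof (induction k arbitrary: q)
  case (Suc k)
  then obtain z where z: "(p, z) \<in> A ^^ k" "(z, q) \<in> A" by auto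
  from Suc.IH[OF z(1)] show ?case
  proof (elim disjE exE conjE)
    fix i assume i: "i \<le> k" "(p, v) \<in> A ^^ i" "(v, z) \<in> A ^^ (k - i)"
    then have "(v, q) \<in> A ^^ (Suc k - i)" using z by (auto simp: Suc_diff_le)
    then show ?thesis using i by (metis le_SucI)
  next
    assume l: "(p, z) \<in> del v ^^ k"
    consider "q = v" | "z = v" | "(z, q) \<in> del v" using z by (auto simp: del_def)
    then show ?thesis
    proof cases
      case 1
      then show ?thesis using z by (intro disjI2 exI[of _ "Suc k"]) auto
    next
      case 2
      then show ?thesis using z by (intro disjI2 exI[of _ k]) auto
    next
      case 3
      then show ?thesis using l by auto
    qed
  qed
qed simp

lemma geodesic_avoid_or_via:
  assumes "p \<in> V" "q \<in> V" "v \<in> V"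
  shows "(p, q) \<in> del v ^^ nat (d p q) \<or> d p q = d p v + d v q"
  using relpow_avoid_or_via[OF relpow_d[OF assms(1,2)], of v]
proof (elim disjE exE conjE)
  fix i assume i: "i \<le> nat (d p q)" "(p, v) \<in> A ^^ i" "(v, q) \<in> A ^^ (nat (d p q) - i)"
  then have "d p v + d v q \<le> d p q"
    using d_le_relpow[OF i(2)] d_le_relpow[OF i(3)] d_nonneg[of p q] by linarith
  then show ?thesis using d_triangle[OF assms(1,3,2)] by linarith
qed simp

text \<open>A shortest path from \<open>z\<close> through its neighbour \<open>v\<close> would give
  \<open>d z w = d v w + 1\<close>.\<close>

lemma geodesic_from_closer:
  assumes "(v, z) \<in> A" "w \<in> V" "d z w \<le> d v w"
  shows "(z, w) \<in> del v ^^ nat (d z w)"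
  using geodesic_avoid_or_via[of z w v] assms A_V[OF assms(1)] d_adj[OF A_sym[OF assms(1)]] by auto

text \<open>A shortest path between the two neighbours of \<open>v\<close> in \<open>G - v\<close> closes up through \<open>v\<close>
  to an isometric cycle.\<close>

lemma isocycle_through:
  assumes nb: "A `` {v} = {u, u'}" "u \<noteq> u'" and con: "(u, u') \<in> (del v)\<^sup>*"
  obtains m c where "isocycle m c" "v \<in> range c"
proof -
  define k where "k = (LEAST k. (u, u') \<in> del v ^^ k)"
  have k: "(u, u') \<in> del v ^^ k"
    using con unfolding k_def rtrancl_power by (rule LeastI_ex)
  have k_min: "k \<le> t" if "(u, u') \<in> del v ^^ t" for t
    using that unfolding k_def by (rule Least_le)
  obtain f where f: "f 0 = u" "f k = u'" "\<And>i. i < k \<Longrightarrow> (f i, f (Suc i)) \<in> del v"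
    using k unfolding relpow_fun_conv by auto
  have k0: "k \<noteq> 0" using f(1,2) nb(2) by metis
  have vu: "(v, u) \<in> A" "(v, u') \<in> A" using nb by auto
  have f_V: "f i \<in> V \<and> f i \<noteq> v" if "i \<le> k" for i
  proof (cases "i = k")
    case True
    then show ?thesis using f vu A_V A_irrefl by metis
  next
    case False
    then have "i < k" using that by simp
    from f(3)[OF this] show ?thesis using A_V by (auto simp: del_def)
  qed
  have seg: "(f i, f (i + t)) \<in> del v ^^ t" if "i + t \<le> k" for i t
    unfolding relpow_fun_conv using f(3) that by (intro exI[of _ "\<lambda>j. f (i + j)"]) auto
  \<comment> \<open>A walk of length \<open>t\<close> in \<open>G - v\<close> from
    \<open>f i\<close> to \<open>f j\<close> replaces the stretch between them; the path was
    shortest, so nothing is gained.\<close>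
  have f_min: "j \<le> i + t" if "i \<le> k" "j \<le> k" "(f i, f j) \<in> del v ^^ t" for i j t
  proof -
    have "(u, f i) \<in> del v ^^ i" using seg[of 0 i] that f by simp
    moreover have "(f j, u') \<in> del v ^^ (k - j)" using seg[of j "k - j"] that f by simp
    ultimately have "(u, u') \<in> del v ^^ (i + t + (k - j))"
      using that(3) unfolding relpow_add by blast
    then show ?thesis using k_min that by fastforce
  qed
  \<comment> \<open>The path has \<open>k + 1\<close> vertices and \<open>v\<close> is one more:
    position 0 holds \<open>v\<close>, position \<open>i + 1\<close> holds
    \<open>f i\<close>.\<close>
  define m where "m = int k + 2"
  define c where "c i = (if i mod m = 0 then v else f (nat (i mod m - 1)))" for i
  have m: "m \<ge> 3" using k0 by (simp add: m_def)
  have per: "c (i mod m) = c i" for i by (simp add: c_def)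
  have c_f: "c (int i + 1) = f i" if "i \<le> k" for i
    using that by (simp add: c_def m_def)
  have c_cases: "c i = v \<and> i mod m = 0 \<or> (\<exists>j\<le>k. c i = f j \<and> i mod m = int j + 1)" for i
  proof (cases "i mod m = 0")
    case False
    have "0 \<le> i mod m" "i mod m < m" using m by auto
    moreover from this have "nat (i mod m - 1) \<le> k" using False unfolding m_def by linarith
    ultimately show ?thesis using False unfolding c_def
      by (intro disjI2 exI[of _ "nat (i mod m - 1)"]) auto
  qed (simp add: c_def)
  have adj: "(c i, c (i + 1)) \<in> A" for i
  proof -
    consider "i mod m = 0" | j where "j < k" "i mod m = int j + 1" | "i mod m = int k + 1"
      using c_cases[of i] by (metis le_neq_implies_less)
    then show ?thesis
    proof cases
      case 1
      have "c (i + 1) = c ((i mod m + 1) mod m)" by (metis per mod_add_left_eq)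
      then have "c (i + 1) = f 0" using 1 c_f[of 0] per by simp
      then show ?thesis using vu f 1 by (simp add: c_def)
    next
      case 2
      have "c (i + 1) = c (int j + 1 + 1)" by (metis per mod_add_left_eq 2(2))
      also have "\<dots> = f (Suc j)" using c_f[of "Suc j"] 2 by (simp add: add.commute)
      finally have "c (i + 1) = f (Suc j)" .
      moreover have "c i = f j" using c_f[of j] 2 by (metis per less_imp_le)
      ultimately show ?thesis using f(3)[OF 2(1)] by (auto simp: del_def)
    next
      case 3
      have "c (i + 1) = c (int k + 1 + 1)" by (metis per mod_add_left_eq 3)
      also have "int k + 1 + 1 = m" by (simp add: m_def)
      also have "c m = v" by (simp add: c_def)
      finally have "c (i + 1) = v" .
      moreover have "c i = u'" using c_f[of k] 3 f by (metis per order_refl)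
      ultimately show ?thesis using vu A_sym by simp
    qed
  qed
  have v_V: "v \<in> V" using vu A_V by blast
  \<comment> \<open>A shortest path from \<open>v\<close> starts at \<open>u = f 0\<close> or
    \<open>u' = f k\<close> and then avoids \<open>v\<close>, so \<open>f_min\<close> bounds its
    length from one end of the path.\<close>
  have dv: "cyc m (int i + 1) \<le> d v (f i)" if i: "i \<le> k" for i
  proof -
    obtain z where z: "(v, z) \<in> A" "d v (f i) = d z (f i) + 1"
      using d_closer[OF v_V] f_V[OF i] by metis
    have "z \<in> A `` {v}" using z by auto
    then have zu: "z = u \<or> z = u'" using nb by auto
    have "(z, f i) \<in> del v ^^ nat (d z (f i))"
      using geodesic_from_closer[OF z(1)] f_V[OF i] z(2) by simp
    then have "i \<le> nat (d z (f i)) \<or> k \<le> i + nat (d z (f i))"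
      using zu f_min[of 0 i] f_min[of i k] f i del_relpow_sym[of z "f i" _ v]
      by auto
    then have "int i + 1 \<le> d v (f i) \<or> int k - int i + 1 \<le> d v (f i)"
      using z(2) d_nonneg[of z "f i"] by linarith
    moreover have "cyc m (int i + 1) = min (int i + 1) (m - (int i + 1))"
      using i by (subst cyc_abs) (auto simp: m_def)
    ultimately show ?thesis by (auto simp: m_def)
  qed
  \<comment> \<open>A shortest path either avoids \<open>v\<close>, and \<open>f_min\<close> applies
    in both directions, or splits at \<open>v\<close>, and the two parts are bounded by
    \<open>dv\<close>.\<close>
  have dff: "cyc m (int i - int j) \<le> d (f i) (f j)" if ij: "i \<le> k" "j \<le> k" for i j
  proof (cases "(f i, f j) \<in> del v ^^ nat (d (f i) (f j))")
    case True
    have "j \<le> i + nat (d (f i) (f j))" "i \<le> j + nat (d (f i) (f j))"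
      using f_min[OF ij True] f_min[OF ij(2,1) del_relpow_sym[OF True]] by auto
    then have "\<bar>int i - int j\<bar> \<le> d (f i) (f j)" using d_nonneg[of "f i" "f j"] by linarith
    moreover have "cyc m (int i - int j) \<le> \<bar>int i - int j\<bar>"
      using ij by (subst cyc_abs) (auto simp: m_def)
    ultimately show ?thesis by simp
  next
    case False
    then have "d (f i) (f j) = d (f i) v + d v (f j)"
      using geodesic_avoid_or_via f_V[OF ij(1)] f_V[OF ij(2)] v_V by metis
    also have "d (f i) v = d v (f i)" using d_commute f_V[OF ij(1)] v_V by metis
    also have "d v (f i) + d v (f j) \<ge> cyc m (int i + 1) + cyc m (int j + 1)"
      using dv[OF ij(1)] dv[OF ij(2)] by simp
    moreover have "cyc m (int i - int j) \<le> cyc m (int i + 1) + cyc m (- (int j + 1))"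
      using cyc_triangle[of m "int i + 1" "- (int j + 1)"] m by simp
    ultimately show ?thesis by (simp only: cyc_uminus)
  qed
  have "d (c i) (c j) = cyc m (i - j)" for i j
  proof (rule antisym)
    show "d (c i) (c j) \<le> cyc m (i - j)" using m by (intro closed_walk_d_le per adj) simp
    have eq: "cyc m (i - j) = cyc m (i mod m - j mod m)"
      by (metis cyc_mod mod_diff_eq)
    show "cyc m (i - j) \<le> d (c i) (c j)"
      unfolding eq using c_cases[of i] c_cases[of j]
    proof (elim disjE conjE exE)
      fix b assume "i mod m = 0" "c i = v" "b \<le> k" "c j = f b" "j mod m = int b + 1"
      then show "cyc m (i mod m - j mod m) \<le> d (c i) (c j)"
        using dv[of b] cyc_uminus[of m "int b + 1"] by simp
    next
      fix a assume "j mod m = 0" "c j = v" "a \<le> k" "c i = f a" "i mod m = int a + 1"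
      then show "cyc m (i mod m - j mod m) \<le> d (c i) (c j)"
        using dv[of a] d_commute[of v "f a"] v_V f_V[of a] by simp
    next
      fix a b assume "a \<le> k" "c i = f a" "i mod m = int a + 1" "b \<le> k" "c j = f b" "j mod m = int b + 1"
      then show "cyc m (i mod m - j mod m) \<le> d (c i) (c j)"
        using dff[of a b] by simp
    qed (simp add: cyc_def)
  qed
  moreover have "range c \<subseteq> V" using adj A_V by blast
  ultimately have "isocycle m c" using m by (simp add: isocycle_def)
  moreover have "v \<in> range c" by (rule range_eqI[of _ _ 0]) (simp add: c_def)
  ultimately show ?thesis by (rule that)
qed

text \<open>Each \<open>w\<close> other than \<open>v\<close> is nearer to one neighbour of
  \<open>v\<close>. The other neighbour is then farther from \<open>w\<close> than \<open>v\<close>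
  is, since otherwise both would reach \<open>w\<close> inside \<open>G - v\<close>. So
  \<open>w\<close> contributes nothing negative, and \<open>w = v\<close> contributes the 2.\<close>

lemma cut_vertex_D:
  assumes nb: "A `` {v} = {u, u'}" "u \<noteq> u'" and cut: "(u, u') \<notin> (del v)\<^sup>*"
  shows "2 * D v + 2 \<le> D u + D u'"
proof -
  have vu: "(v, u) \<in> A" "(v, u') \<in> A" using nb by auto
  have v_V: "v \<in> V" using vu A_V by blast
  have *: "d v w + 1 \<le> d y w"
    if "w \<in> V" "{x, y} = {u, u'}" "d v w = d x w + 1" for w x y
  proof (rule ccontr)
    assume "\<not> d v w + 1 \<le> d y w"
    then have y: "d y w \<le> d v w" by simp
    have "(v, x) \<in> A" "(v, y) \<in> A" using that(2) vu by (metis insertCI insertE singletonD)+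
    then have "(x, w) \<in> (del v)\<^sup>*" "(y, w) \<in> (del v)\<^sup>*"
      using geodesic_from_closer[of v x w] geodesic_from_closer[of v y w] y that
      unfolding rtrancl_power by auto
    then have "(x, y) \<in> (del v)\<^sup>*" "(y, x) \<in> (del v)\<^sup>*"
      using del_rtrancl_sym rtrancl_trans by metis+
    then show False using that(2) cut by (auto simp: doubleton_eq_iff)
  qed
  have "2 * d v w \<le> d u w + d u' w" if w: "w \<in> V - {v}" for w
  proof -
    obtain z where z: "(v, z) \<in> A" "d v w = d z w + 1" using d_closer[of v w] v_V w by auto
    then have "z \<in> {u, u'}" using nb by auto
    then show ?thesis using *[of w u u'] *[of w u' u] z w by (auto simp: insert_commute)
  qed
  then have "(\<Sum>w\<in>V - {v}. 2 * d v w) \<le> (\<Sum>w\<in>V - {v}. d u w + d u' w)" by (intro sum_mono) auto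
  moreover have "D x = d x v + (\<Sum>w\<in>V - {v}. d x w)" for x
    unfolding D_def using finite_V v_V by (rule sum.remove)
  moreover have "d u v = 1" "d u' v = 1" using d_adj vu A_sym by auto
  ultimately show ?thesis by (simp add: sum.distrib sum_distrib_left[symmetric])
qed

text \<open>Descending to \<open>s\<close> step by step without meeting \<open>v\<close> connects
  both neighbours of \<open>v\<close> to \<open>s\<close> in \<open>G - v\<close>, which is what
  \<open>isocycle_through\<close> requires.\<close>

lemma isocycle_through_if_descent:
  assumes nb: "A `` {v} = {u, u'}" "u \<noteq> u'" and s: "s \<in> V" "s \<noteq> v"
    and desc: "\<And>w. w \<in> V \<Longrightarrow> w \<noteq> v \<Longrightarrow> w \<noteq> s \<Longrightarrow> \<exists>w'. (w, w') \<in> A \<and> w' \<noteq> v \<and> d s w' < d s w"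
  obtains m c where "isocycle m c" "v \<in> range c"
proof -
  have to_s: "(w, s) \<in> (del v)\<^sup>*" if "w \<in> V" "w \<noteq> v" for w
    using that
  proof (induction "nat (d s w)" arbitrary: w rule: less_induct)
    case less
    show ?case
    proof (cases "w = s")
      case False
      then obtain w' where w': "(w, w') \<in> A" "w' \<noteq> v" "d s w' < d s w" using desc less.prems by blast
      then have "(w', s) \<in> (del v)\<^sup>*" using less.hyps[of w'] d_nonneg[of s w'] A_V by auto
      moreover have "(w, w') \<in> del v" using w' less.prems by (simp add: del_def)
      ultimately show ?thesis by (rule converse_rtrancl_into_rtrancl[rotated])
    qed simp
  qed
  have "(v, u) \<in> A" "(v, u') \<in> A" using nb by auto
  then have "(u, s) \<in> (del v)\<^sup>*" "(u', s) \<in> (del v)\<^sup>*"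
    using to_s A_V A_irrefl by metis+
  then have "(u, u') \<in> (del v)\<^sup>*"
    using del_rtrancl_sym rtrancl_trans by metis
  from isocycle_through[OF nb this] that show ?thesis by blast
qed

text \<open>A vertex farthest from \<open>s\<close> is never the next vertex on a shortest path
  towards \<open>s\<close>.\<close>

lemma isocycle_through_farthest:
  assumes nb: "A `` {v} = {u, u'}" "u \<noteq> u'" and s: "s \<in> V" "s \<noteq> v"
    and far: "\<And>w. w \<in> V \<Longrightarrow> d s w \<le> d s v"
  obtains m c where "isocycle m c" "v \<in> range c"
proof (rule isocycle_through_if_descent[OF nb s])
  fix w assume w: "w \<in> V" "w \<noteq> v" "w \<noteq> s"
  obtain w' where w': "(w, w') \<in> A" "d w s = d w' s + 1" using d_closer[OF w(1) s(1) w(3)] .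
  then have "d s w' < d s w" using d_commute s w A_V by (metis less_add_one)
  then show "\<exists>w'. (w, w') \<in> A \<and> w' \<noteq> v \<and> d s w' < d s w" using w' far[OF w(1)] by force
qed (use that in blast)

context
  fixes m c assumes iso: "isocycle m c"
begin

lemma iso_arcs_card: "card (A \<inter> range c \<times> range c) = 2 * card (range c)"
proof -
  have "A \<inter> range c \<times> range c = (SIGMA v:range c. A `` {v} \<inter> range c)" by auto
  moreover have "card (A `` {v} \<inter> range c) = 2" if "v \<in> range c" for v
    using that iso_nbrs_card[OF iso] by auto
  ultimately show ?thesis using iso_finite[OF iso] by simp
qed

lemma iso_subset: "range c \<subseteq> V"
  using iso by (auto simp: isocycle_def)

end

section \<open>The cycle with one duplicated vertex\<close>

text \<open>The graph \<open>B_n\<close> with \<open>n = m + 1\<close> in coordinates: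
  \<open>z\<close> is the duplicate of \<open>c 0\<close>.\<close>

definition twin_cycle :: "int \<Rightarrow> (int \<Rightarrow> 'a) \<Rightarrow> 'a \<Rightarrow> bool" where
  "twin_cycle m c z \<longleftrightarrow>
     isocycle m c \<and> z \<notin> range c \<and> V = insert z (range c) \<and> A `` {z} = {c 1, c (- 1)}"

text \<open>All walks from \<open>v\<close> start with \<open>u\<close>, so each of the other
  \<open>card V - 1\<close> vertices contributes 1, while \<open>v\<close> itself contributes
  -1.\<close>

lemma pendant_D_diff:
  assumes "v \<in> V" "A `` {v} = {u}"
  shows "D v - D u = int (card V) - 2"
proof -
  have vu: "(v, u) \<in> A" "u \<in> V" "u \<noteq> v" using assms A_V A_irrefl by auto
  have "d v w - d u w = 1" if "w \<in> V - {v}" for w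
  proof -
    have w: "w \<in> V" "v \<noteq> w" using that by auto
    obtain z where "(v, z) \<in> A" "d v w = d z w + 1" using d_closer[OF assms(1) w] .
    then show ?thesis using assms by auto
  qed
  then have "(\<Sum>w\<in>V - {v}. d v w - d u w) = int (card (V - {v}))" by simp
  moreover have "D x = d x v + (\<Sum>w\<in>V - {v}. d x w)" for x
    unfolding D_def using finite_V assms(1) by (rule sum.remove)
  moreover have "d u v = 1" using vu A_sym d_adj by blast
  moreover have "int (card (V - {v})) = int (card V) - 1"
    using assms(1) finite_V card_gt_0_iff[of V] by (auto simp: of_nat_diff)
  ultimately show ?thesis by (simp add: sum_subtractf)
qed

lemma twin_cycle_arcs:
  assumes "twin_cycle m c z"
  shows "A = range (\<lambda>i. (c i, c (i + 1))) \<union> range (\<lambda>i. (c (i + 1), c i)) \<union>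
    {(z, c 1), (z, c (- 1)), (c 1, z), (c (- 1), z)}" (is "A = ?B")
proof -
  have iso: "isocycle m c" and z: "z \<notin> range c" "V = insert z (range c)" "A `` {z} = {c 1, c (- 1)}"
    using assms by (auto simp: twin_cycle_def)
  have nz: "q = c 1 \<or> q = c (- 1)" if "(z, q) \<in> A" for q using z(3) that by auto
  have "(p, q) \<in> ?B" if pq: "(p, q) \<in> A" for p q
  proof -
    have "p = z \<or> p \<in> range c" "q = z \<or> q \<in> range c" using A_V[OF pq] unfolding z(2) by auto
    then consider "p = z" | "q = z" | i where "p = c i" "q \<in> range c" by auto
    then show ?thesis
    proof cases
      case 1
      then show ?thesis using nz pq by auto
    next
      case 2
      then show ?thesis using nz A_sym[OF pq] by auto
    next
      case 3
      then have "q \<in> {c (i - 1), c (i + 1)}" using iso_nbrs[OF iso, of i] pq by auto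
      moreover have "(c i, c (i + 1)) \<in> range (\<lambda>i. (c i, c (i + 1)))" by blast
      moreover have "(c i, c (i - 1)) \<in> range (\<lambda>i. (c (i + 1), c i))"
        by (rule range_eqI[of _ _ "i - 1"]) simp
      ultimately show ?thesis using 3 by auto
    qed
  qed
  moreover have "?B \<subseteq> A"
    using iso_adj(1)[OF iso] A_sym[OF iso_adj(1)[OF iso]] z(3) A_sym[of z] by auto
  ultimately show ?thesis by auto
qed

lemma twin_cycle_card:
  assumes "twin_cycle m c z"
  shows "int (card V) = m + 1" "int (card A) = 2 * m + 4"
proof -
  have iso: "isocycle m c" and z: "z \<notin> range c" "V = insert z (range c)" "A `` {z} = {c 1, c (- 1)}"
    using assms by (auto simp: twin_cycle_def)
  show "int (card V) = m + 1"
    unfolding z(2) using z(1) iso_finite[OF iso] iso_card[OF iso] by simp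
  let ?C = "A \<inter> range c \<times> range c" and ?Z = "{(z, c 1), (z, c (- 1)), (c 1, z), (c (- 1), z)}"
  have "A = ?C \<union> ?Z"
  proof
    have "(a, b) \<in> ?C \<union> ?Z" if "(a, b) \<in> A" for a b
    proof (cases "(a, b) \<in> ?Z")
      case False
      then have "(a, b) \<in> range (\<lambda>i. (c i, c (i + 1))) \<union> range (\<lambda>i. (c (i + 1), c i))"
        using that unfolding twin_cycle_arcs[OF assms] by blast
      then show ?thesis using that by auto
    qed blast
    then show "A \<subseteq> ?C \<union> ?Z" by auto
    show "?C \<union> ?Z \<subseteq> A" using z(3) A_sym[of z] by auto
  qed
  moreover have "card (?C \<union> ?Z) = card ?C + card ?Z"
    using finite_A z(1) by (intro card_Un_disjoint) auto
  moreover have "card ?Z = 4"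
  proof -
    have "c 1 \<noteq> c (- 1)" by (rule iso_neq[OF iso]) (use iso_m[OF iso] in auto)
    moreover have "c 1 \<noteq> z" "c (- 1) \<noteq> z" using z(1) by auto
    ultimately show ?thesis by simp
  qed
  ultimately have "card A = 2 * card (range c) + 4" using iso_arcs_card[OF iso] by simp
  then show "int (card A) = 2 * m + 4" using iso_card[OF iso] by linarith
qed

text \<open>A shortest path from one of the two to a third vertex starts at a common neighbour, so
  it serves the other one as well.\<close>

lemma twins_D_eq:
  assumes "u \<in> V" "v \<in> V" "A `` {u} = A `` {v}"
  shows "D u = D v"
proof -
  have le: "d u w \<le> d v w" if asm: "w \<in> V - {u, v}" "v \<in> V" "A `` {u} = A `` {v}" for u v w
  proof -
    have w: "w \<in> V" "v \<noteq> w" using asm by auto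
    obtain y where y: "(v, y) \<in> A" "d v w = d y w + 1" using d_closer[OF asm(2) w] .
    then have "(u, y) \<in> A" using asm(3) by auto
    then show ?thesis using d_adj_le[of u y w] w y by simp
  qed
  have "d u w = d v w" if "w \<in> V - {u, v}" for w
    using le[of w u v] le[of w v u] that assms by (auto simp: insert_commute)
  then have "(\<Sum>w\<in>V - {u, v}. d u w) = (\<Sum>w\<in>V - {u, v}. d v w)" by simp
  moreover have "D x = (\<Sum>w\<in>V - {u, v}. d x w) + (\<Sum>w\<in>{u, v}. d x w)" for x
    unfolding D_def using finite_V assms by (intro sum.subset_diff) auto
  moreover have "(\<Sum>w\<in>{u, v}. d u w) = (\<Sum>w\<in>{u, v}. d v w)"
    using d_commute[OF assms(1,2)] by (cases "u = v") auto
  ultimately show ?thesis by simp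
qed

text \<open>On the cycle only the term of \<open>z\<close> survives in a difference of
  \<open>D\<close>, and it changes by at most 1 along an edge. The edges at \<open>z\<close> reduce
  to those at its twin \<open>c 0\<close>.\<close>

lemma twin_cycle_flat:
  assumes "twin_cycle m c z" "(u, v) \<in> A"
  shows "\<bar>D u - D v\<bar> \<le> 1"
proof -
  have iso: "isocycle m c" and z: "z \<notin> range c" "V = insert z (range c)" "A `` {z} = {c 1, c (- 1)}"
    using assms by (auto simp: twin_cycle_def)
  have "V - range c = {z}" using z by auto
  then have diff: "D (c i) - D (c j) = d (c i) z - d (c j) z" for i j
    using iso_D_diff[OF iso, of i j] by simp
  have zV: "z \<in> V" using z by blast
  have step: "\<bar>D (c (i + 1)) - D (c i)\<bar> \<le> 1" for i
    using diff[of "i + 1" i] d_adj_le[OF iso_adj(1)[OF iso, of i] zV]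
      d_adj_le[OF A_sym[OF iso_adj(1)[OF iso, of i]] zV] by auto
  have "c 0 \<notin> A `` {z}"
    unfolding z(3) using iso_neq[OF iso, of 0 1] iso_neq[OF iso, of 0 "- 1"] iso_m[OF iso] by auto
  then have "A `` {c 0} \<subseteq> range c" using A_V[of "c 0"] A_sym[of "c 0"] z(2) by blast
  then have "A `` {c 0} = A `` {z}" using iso_nbrs[OF iso, of 0] z(3) by auto
  then have "D z = D (c 0)" using zV iso_V[OF iso] by (intro twins_D_eq) auto
  then have "\<bar>D z - D (c 1)\<bar> \<le> 1" "\<bar>D z - D (c (- 1))\<bar> \<le> 1" using step[of 0] step[of "- 1"] by auto
  then show ?thesis using assms(2) step unfolding twin_cycle_arcs[OF assms(1)]
    by (auto simp: abs_minus_commute)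
qed

lemma twin_cycle_sum_sq_le:
  assumes "twin_cycle m c z"
  shows "(\<Sum>(u, v)\<in>A. (D u - D v)\<^sup>2) \<le> 2 * int (card V) + 2"
proof -
  have "(D u - D v)\<^sup>2 \<le> 1" if "(u, v) \<in> A" for u v
    using power_mono[OF twin_cycle_flat[OF assms that], of 2] by simp
  then have "(\<Sum>(u, v)\<in>A. (D u - D v)\<^sup>2) \<le> (\<Sum>e\<in>A. 1)" by (intro sum_mono) auto
  then show ?thesis using twin_cycle_card[OF assms] by simp
qed

end

text \<open>Send \<open>z\<close> to \<open>z'\<close> and \<open>c i\<close> to
  \<open>c' i\<close>. The choice of the index is immaterial because \<open>c\<close> and
  \<open>c'\<close> both identify exactly the indices congruent modulo \<open>m\<close>.\<close>

lemma twin_cycle_iso: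
  assumes "connected_graph V A" "connected_graph.twin_cycle V A m c z"
    and "connected_graph V' A'" "connected_graph.twin_cycle V' A' m c' z'"
  obtains f where "inj_on f V" "f ` V = V'" "map_prod f f ` A = A'"
proof
  interpret G: connected_graph V A by fact
  interpret H: connected_graph V' A' by fact
  have iso: "G.isocycle m c" and z: "z \<notin> range c" "V = insert z (range c)"
    using assms(2) by (auto simp: G.twin_cycle_def)
  have iso': "H.isocycle m c'" and z': "z' \<notin> range c'" "V' = insert z' (range c')"
    using assms(4) by (auto simp: H.twin_cycle_def)
  define f where "f w = (if w = z then z' else c' (SOME i. c i = w))" for w
  have fz: "f z = z'" by (simp add: f_def)
  have fc: "f (c i) = c' i" for i
  proof -
    have "c (SOME j. c j = c i) = c i" by (rule someI) simp
    then have "c' (SOME j. c j = c i) = c' i" using G.iso_eq_iff[OF iso] H.iso_eq_iff[OF iso'] by blast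
    moreover have "c i \<noteq> z" using z by auto
    ultimately show ?thesis by (simp add: f_def)
  qed
  have "f (c i) = f (c j) \<Longrightarrow> c i = c j" for i j
    unfolding fc G.iso_eq_iff[OF iso] H.iso_eq_iff[OF iso'] .
  moreover have "f (c i) \<noteq> f z" for i using z'(1) fc fz by (metis rangeI)
  ultimately show "inj_on f V" unfolding z(2) inj_on_def by (metis insertE rangeE)
  show "f ` V = V'" unfolding z(2) z'(2) by (simp add: fz fc image_image)
  have r1: "map_prod f f ` range (\<lambda>i. (c i, c (i + 1))) = range (\<lambda>i. (c' i, c' (i + 1)))"
    by (simp add: image_image fc)
  have r2: "map_prod f f ` range (\<lambda>i. (c (i + 1), c i)) = range (\<lambda>i. (c' (i + 1), c' i))"
    by (simp add: image_image fc)
  show "map_prod f f ` A = A'"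
    unfolding G.twin_cycle_arcs[OF assms(2)] H.twin_cycle_arcs[OF assms(4)]
    unfolding image_Un r1 r2 by (simp only: image_insert image_empty map_prod_simp fz fc)
qed

section \<open>Bicyclic graphs without pendant vertices\<close>

text \<open>Each of the \<open>card V + 1\<close> edges counts as two arcs. Pendant vertices are
  treated separately in the final proof.\<close>

locale bicyclic_graph = connected_graph +
  assumes card_A_eq: "card A = 2 * card V + 2"
    and deg_ge_2: "v \<in> V \<Longrightarrow> 2 \<le> card (A `` {v})"
begin

lemma card_arcs_from_ge: "K \<subseteq> V \<Longrightarrow> 2 * card K \<le> card (A \<inter> K \<times> UNIV)"
  using sum_bounded_below[of K 2 "\<lambda>v. card (A `` {v})"] deg_ge_2
  by (auto simp: card_arcs_from mult.commute)

text \<open>The degrees sum to \<open>2 * card V + 2\<close>, so they exceed 2 by a total of only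
  2.\<close>

lemma card_deg_2: "card V \<le> card {v \<in> V. card (A `` {v}) = 2} + 2"
proof -
  let ?T = "{v \<in> V. card (A `` {v}) = 2}"
  have "(\<Sum>v\<in>V - ?T. 3) + (\<Sum>v\<in>?T. 2) \<le> (\<Sum>v\<in>V - ?T. card (A `` {v})) + (\<Sum>v\<in>?T. card (A `` {v}))"
    using deg_ge_2 by (intro add_mono sum_mono) (fastforce simp: le_less)+
  also have "\<dots> = card A" unfolding card_A using finite_V by (intro sum.subset_diff[symmetric]) auto
  finally have "3 * card (V - ?T) + 2 * card ?T \<le> 2 * card V + 2" by (simp add: card_A_eq)
  moreover have "card (V - ?T) + card ?T = card V"
    using finite_V card_Diff_subset[of ?T V] card_mono[of V ?T] by auto
  ultimately show ?thesis by linarith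
qed

text \<open>Two vertices of degree at least 3 use up the total excess of 2.\<close>

lemma deg_eq_2_if_two_branch:
  assumes "x \<in> V" "y \<in> V" "x \<noteq> y" "3 \<le> card (A `` {x})" "3 \<le> card (A `` {y})" "v \<in> V - {x, y}"
  shows "card (A `` {v}) = 2"
proof -
  let ?W = "V - {x, y, v}"
  have "card A = (\<Sum>w\<in>?W. card (A `` {w})) + (\<Sum>w\<in>{x, y, v}. card (A `` {w}))"
    unfolding card_A using assms finite_V by (intro sum.subset_diff) auto
  also have "(\<Sum>w\<in>{x, y, v}. card (A `` {w})) = card (A `` {x}) + card (A `` {y}) + card (A `` {v})"
    using assms by auto
  also have "2 * card ?W \<le> (\<Sum>w\<in>?W. card (A `` {w}))"
    using card_arcs_from_ge[of ?W] card_arcs_from[of ?W] by auto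
  moreover have "card V = card ?W + 3"
    using assms finite_V card_Diff_subset[of "{x, y, v}" V] card_mono[of V "{x, y, v}"] by auto
  moreover have "2 \<le> card (A `` {v})" using deg_ge_2 assms by auto
  ultimately show ?thesis using card_A_eq assms by linarith
qed

section \<open>The part of the graph outside an isometric cycle\<close>

context
  fixes m c assumes iso: "isocycle m c"
begin

lemma iso_rest_nonempty: "V - range c \<noteq> {}"
proof
  assume "V - range c = {}"
  then have "range c = V" using iso_subset[OF iso] by auto
  moreover from this have "A \<inter> range c \<times> range c = A" using A_subset by auto
  ultimately show False using iso_arcs_card[OF iso] card_A_eq by simp
qed

lemma card_V_iso: "int (card V) = m + int (card (V - range c))"
  using iso_card[OF iso] card_Diff_subset[OF iso_finite[OF iso] iso_subset[OF iso]]
    card_mono[OF finite_V iso_subset[OF iso]] by linarith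

text \<open>The degrees give \<open>2 * card K\<close> arcs leaving vertices of \<open>K\<close>,
  connectedness an additional arc that enters \<open>K\<close> from outside, and parity one
  more.\<close>

lemma card_arcs_touching:
  assumes K: "K \<subseteq> V - range c" "K \<noteq> {}"
  shows "2 * card K + 2 \<le> card (A \<inter> (K \<times> UNIV \<union> UNIV \<times> K))" (is "_ \<le> card ?T")
proof -
  have "c 0 \<in> V - K" using K iso_subset[OF iso] by auto
  then obtain u v where uv: "u \<in> K" "v \<in> V - K" "(u, v) \<in> A"
    using A_boundary[of K] K by (metis Diff_iff Diff_subset order_trans)
  have "Suc (2 * card K) \<le> card (insert (v, u) (A \<inter> K \<times> UNIV))"
    using card_arcs_from_ge[of K] K uv finite_A by (subst card_insert_disjoint) auto
  also have "\<dots> \<le> card ?T" using uv A_sym finite_A by (intro card_mono) auto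
  finally have "Suc (2 * card K) \<le> card ?T" .
  moreover have "even (card ?T)"
    using A_sym A_irrefl finite_A by (intro even_card_sym) auto
  ultimately show ?thesis by presburger
qed

text \<open>Each component of \<open>G - C\<close> touches more edges than it has vertices, and there is only one
  edge to spare.\<close>

lemma iso_rest_boundary:
  assumes K: "K \<subseteq> V - range c" "K \<noteq> {}" "K \<noteq> V - range c"
  obtains u v where "u \<in> K" "v \<in> V - range c - K" "(u, v) \<in> A"
proof -
  define K' where "K' = V - range c - K"
  have K': "K' \<subseteq> V - range c" "K' \<noteq> {}" using K by (auto simp: K'_def)
  \<comment> \<open>The arcs touching \<open>K\<close>, those touching \<open>K'\<close> and those
    inside the cycle would be disjoint sets with at least \<open>2 * card V + 4\<close> arcs in
    total, two too many.\<close>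
  have False if no: "\<And>u v. u \<in> K \<Longrightarrow> v \<in> K' \<Longrightarrow> (u, v) \<notin> A"
  proof -
    let ?T = "\<lambda>K. A \<inter> (K \<times> UNIV \<union> UNIV \<times> K)"
    have "?T K \<inter> ?T K' = {}"
      using no A_sym by (auto simp: K'_def)
    then have "card (?T K \<union> ?T K') = card (?T K) + card (?T K')"
      using finite_A by (intro card_Un_disjoint) auto
    moreover have "card (?T K \<union> ?T K' \<union> (A \<inter> range c \<times> range c)) =
        card (?T K \<union> ?T K') + card (A \<inter> range c \<times> range c)"
      using finite_A K K' by (intro card_Un_disjoint) auto
    moreover have "card (?T K \<union> ?T K' \<union> (A \<inter> range c \<times> range c)) \<le> card A"
      using finite_A by (intro card_mono) auto
    moreover have "card V = card K + card K' + card (range c)"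
    proof -
      have "card K' + card K = card (V - range c)"
        unfolding K'_def using K finite_V card_Diff_subset[of K "V - range c"] card_mono[of "V - range c" K]
        by (metis add.commute finite_Diff finite_subset le_add_diff_inverse)
      then show ?thesis using card_V_iso iso_card[OF iso] by linarith
    qed
    ultimately show False
      using card_arcs_touching[OF K(1,2)] card_arcs_touching[OF K'] iso_arcs_card[OF iso] card_A_eq by linarith
  qed
  then show ?thesis using that unfolding K'_def by blast
qed

text \<open>The cycle holds twice as many arcs as vertices, and at least twice as many arcs leave
  the outside vertices as there are such vertices; 2 arcs remain.\<close>

lemma iso_attach_card: "card (A \<inter> range c \<times> (V - range c)) \<le> 2"
proof -
  let ?R = "V - range c"
  have "card A = card ((A \<inter> range c \<times> range c) \<union> (A \<inter> range c \<times> ?R) \<union> (A \<inter> ?R \<times> UNIV))"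
    using A_subset by (intro arg_cong[of _ _ card]) auto
  also have "\<dots> = card (A \<inter> range c \<times> range c) + card (A \<inter> range c \<times> ?R) + card (A \<inter> ?R \<times> UNIV)"
    using finite_A by (subst card_Un_disjoint, simp, simp, blast)+ simp
  finally show ?thesis
    using iso_arcs_card[OF iso] card_arcs_from_ge[of ?R] card_A_eq card_V_iso iso_card[OF iso] by auto
qed

text \<open>Every outside vertex is nearer to one neighbour of \<open>c i\<close> than to
  \<open>c i\<close>, so its distances to the two neighbours average at most its distance to
  \<open>c i\<close>. If neither neighbour were lower, equality would hold for every outside
  vertex.\<close>

lemma iso_D_lower:
  assumes "card (A `` {c i}) = 2"
  shows "D (c (i - 1)) < D (c i) \<or> D (c (i + 1)) < D (c i)"
proof (rule ccontr)
  let ?R = "V - range c" and ?u = "c (i - 1)" and ?u' = "c (i + 1)" and ?v = "c i"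
  assume "\<not> ?thesis"
  then have ge: "D ?v \<le> D ?u" "D ?v \<le> D ?u'" by auto
  have nb: "A `` {?v} = {?u, ?u'}" using iso_deg2[OF iso assms] .
  have V: "c j \<in> V" for j using iso_subset[OF iso] by auto
  have vu: "(?v, ?u) \<in> A" "(?v, ?u') \<in> A" using nb by auto
  have up: "d ?u w \<le> d ?v w + 1" "d ?u' w \<le> d ?v w + 1" if "w \<in> V" for w
    using d_adj_le[OF A_sym] vu that by auto
  have le: "d ?u w + d ?u' w \<le> 2 * d ?v w" if "w \<in> ?R" for w
  proof -
    have w: "w \<in> V" "?v \<noteq> w" using that by auto
    obtain z where "(?v, z) \<in> A" "d ?v w = d z w + 1" using d_closer[OF V w] .
    moreover from this have "z \<in> {?u, ?u'}" using nb by auto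
    ultimately show ?thesis using up that by fastforce
  qed
  have sums: "(\<Sum>w\<in>?R. d ?u w - d ?v w) \<ge> 0" "(\<Sum>w\<in>?R. d ?u' w - d ?v w) \<ge> 0"
    using ge iso_D_diff[OF iso, of "i - 1" i] iso_D_diff[OF iso, of "i + 1" i] by auto
  have s_le: "(\<Sum>w\<in>?R. (d ?u w - d ?v w) + (d ?u' w - d ?v w)) \<ge> 0"
    unfolding sum.distrib using sums by simp
  have eq: "d ?u w + d ?u' w = 2 * d ?v w" if "w \<in> ?R" for w
  proof (rule ccontr)
    assume "d ?u w + d ?u' w \<noteq> 2 * d ?v w"
    then have "(\<Sum>w\<in>?R. (d ?u w - d ?v w) + (d ?u' w - d ?v w)) < (\<Sum>w\<in>?R. 0)"
      using le that finite_V by (intro sum_strict_mono_ex1) (force intro!: bexI[of _ w])+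
    then show False using s_le by simp
  qed
  have pm: "d ?u w = d ?v w - 1 \<and> d ?u' w = d ?v w + 1 \<or> d ?u w = d ?v w + 1 \<and> d ?u' w = d ?v w - 1"
    if "w \<in> ?R" for w
  proof -
    have w: "w \<in> V" "?v \<noteq> w" using that by auto
    obtain z where "(?v, z) \<in> A" "d ?v w = d z w + 1" using d_closer[OF V w] .
    moreover from this have "z \<in> {?u, ?u'}" using nb by auto
    ultimately show ?thesis using eq[OF that] by auto
  qed
  \<comment> \<open>The outside vertices are now split by the neighbour that is nearer to them. If
    all were on one side, that neighbour would be lower; if not, connectedness gives an edge between
    the two sides.\<close>
  define K where "K = {w \<in> ?R. d ?u w < d ?v w}"
  have K: "K \<subseteq> ?R" by (auto simp: K_def)
  consider "K = {}" | "K = ?R" | "K \<noteq> {}" "K \<noteq> ?R" by blast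
  then show False
  proof cases
    case 1
    then have "d ?u' w - d ?v w = - 1" if "w \<in> ?R" for w using pm[OF that] that by (auto simp: K_def)
    then show False using sums(2) iso_rest_nonempty finite_V by (simp add: card_gt_0_iff)
  next
    case 2
    have "d ?u w - d ?v w = - 1" if "w \<in> ?R" for w
    proof -
      have "w \<in> K" using that 2 by blast
      then show ?thesis using pm[OF that] by (auto simp: K_def)
    qed
    then show False using sums(1) iso_rest_nonempty finite_V by (simp add: card_gt_0_iff)
  next
    case 3
    then obtain a b where ab: "a \<in> K" "b \<in> ?R - K" "(a, b) \<in> A" using iso_rest_boundary[OF K] by blast
    then have aR: "a \<in> ?R" "b \<in> ?R" using K by auto
    have a: "d ?u a = d ?v a - 1" "d ?u' a = d ?v a + 1" using pm[OF aR(1)] ab(1) by (auto simp: K_def)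
    have b: "d ?u b = d ?v b + 1" "d ?u' b = d ?v b - 1" using pm[OF aR(2)] ab(2) by (auto simp: K_def)
    \<comment> \<open>These bounds make each of the adjacent vertices \<open>a\<close> and
      \<open>b\<close> strictly nearer to \<open>c i\<close> than the other.\<close>
    have "d ?u b \<le> d ?u a + 1" "d ?u' a \<le> d ?u' b + 1"
      using d_adj_le[OF A_sym[OF ab(3)], of ?u] d_adj_le[OF ab(3), of ?u'] d_commute V aR by auto
    then show False using a b by simp
  qed
qed

end

text \<open>On isometric cycles vertices of degree 2 have a lower neighbour, elsewhere a higher one;
  so assigning such a neighbour to each vertex never uses an edge twice.\<close>

lemma card_nonzero_arcs: "2 * card V \<le> card {(u, v) \<in> A. D u \<noteq> D v} + 4"
proof -
  define P where "P = {v. \<exists>m c. isocycle m c \<and> v \<in> range c}"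
  define T where "T = {v \<in> V. card (A `` {v}) = 2}"
  have ex: "\<exists>w. (v, w) \<in> A \<and> (v \<in> P \<longrightarrow> w \<in> P \<and> D w < D v) \<and> (v \<notin> P \<longrightarrow> D v < D w)"
    if v: "v \<in> T" for v
  proof (cases "v \<in> P")
    case True
    then obtain m c i where mc: "isocycle m c" "v = c i" by (auto simp: P_def)
    have "c j \<in> P" for j using mc by (auto simp: P_def)
    then show ?thesis
      using iso_D_lower[OF mc(1), of i] v True iso_adj[OF mc(1), of i] by (auto simp: T_def mc(2))
  next
    case False
    obtain u u' where nb: "A `` {v} = {u, u'}" "u \<noteq> u'"
      using v by (auto simp: T_def card_2_iff)
    have "(u, u') \<notin> (del v)\<^sup>*"
      using isocycle_through[OF nb] False by (auto simp: P_def)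
    from cut_vertex_D[OF nb this] have "D v < D u \<or> D v < D u'" by linarith
    then show ?thesis using nb False by auto
  qed
  then obtain g where g: "\<And>v. v \<in> T \<Longrightarrow> (v, g v) \<in> A"
    "\<And>v. v \<in> T \<Longrightarrow> v \<in> P \<Longrightarrow> g v \<in> P \<and> D (g v) < D v" "\<And>v. v \<in> T \<Longrightarrow> v \<notin> P \<Longrightarrow> D v < D (g v)"
    by metis
  let ?N = "{(u, v) \<in> A. D u \<noteq> D v}"
  have fN: "finite ?N" using finite_A by (auto intro: finite_subset[of _ A])
  let ?E = "(\<lambda>v. (v, g v)) ` T" and ?F = "(\<lambda>v. (g v, v)) ` T"
  have fT: "finite T" using finite_V by (simp add: T_def)
  have sub: "?E \<union> ?F \<subseteq> ?N"
    using g A_sym by (auto dest: less_imp_neq) (metis less_irrefl)+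
  \<comment> \<open>If \<open>v\<close> and \<open>w\<close> chose each other, then both or neither
    would be in \<open>P\<close>, since choices made in \<open>P\<close> stay in \<open>P\<close>;
    so \<open>D\<close> would have to change the same way in both directions.\<close>
  have "?E \<inter> ?F = {}"
  proof (rule ccontr)
    assume "?E \<inter> ?F \<noteq> {}"
    then obtain v w where vw: "v \<in> T" "w \<in> T" "v = g w" "g v = w" by auto
    then show False using g(2,3)[of v] g(2,3)[of w] by fastforce
  qed
  then have "card (?E \<union> ?F) = card ?E + card ?F" using fT by (intro card_Un_disjoint) auto
  also have "card ?E = card T" by (intro card_image inj_onI) auto
  also have "card ?F = card T" by (intro card_image inj_onI) auto
  finally have "2 * card T \<le> card ?N"
    using card_mono[OF fN sub] by simp
  \<comment> \<open>At most two vertices have no edge assigned to them, which costs 4 arcs.\<close>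
  then show ?thesis using card_deg_2 by (simp add: T_def)
qed

text \<open>At least \<open>2 * card V - 4\<close> arcs contribute 1 or more, and the four arcs of
  the two steep edges contribute 4 or more each: in total at least
  \<open>2 * card V + 8\<close>.\<close>

lemma sum_sq_if_steep:
  assumes ab: "(a, b) \<in> A" "2 \<le> \<bar>D a - D b\<bar>" and ab': "(a', b') \<in> A" "2 \<le> \<bar>D a' - D b'\<bar>"
    and ne: "{a, b} \<noteq> {a', b'}"
  shows "2 * int (card V) + 2 < (\<Sum>(u, v)\<in>A. (D u - D v)\<^sup>2)"
proof -
  let ?N = "{(u, v) \<in> A. D u \<noteq> D v}" and ?L = "{(a, b), (b, a), (a', b'), (b', a')}"
  have fN: "finite ?N" using finite_A by (auto intro: finite_subset[of _ A])
  have L: "?L \<subseteq> ?N" using ab ab' A_sym by auto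
  have neq: "a \<noteq> b" "a' \<noteq> b'" "(a, b) \<noteq> (a', b')" "(a, b) \<noteq> (b', a')"
    using ab ab' ne A_irrefl by (blast, blast, blast, blast)
  have L4: "card ?L = 4"
    using neq by (subst card_insert_disjoint; force)+
  have cN: "card ?N = card (?N - ?L) + 4"
    using card_Diff_subset[OF finite_subset[OF L fN] L] card_mono[OF fN L] unfolding L4 by linarith
  have sq4: "4 \<le> x\<^sup>2" if "2 \<le> \<bar>x\<bar>" for x :: int
    using power_mono[OF that, of 2] by simp
  have sq1: "1 \<le> x\<^sup>2" if "x \<noteq> 0" for x :: int
    using that by (metis int_one_le_iff_zero_less zero_less_power2)
  have "(\<Sum>e\<in>?N - ?L. 1) + (\<Sum>e\<in>?L. 4) \<le>
      (\<Sum>e\<in>?N - ?L. case e of (u, v) \<Rightarrow> (D u - D v)\<^sup>2) + (\<Sum>e\<in>?L. case e of (u, v) \<Rightarrow> (D u - D v)\<^sup>2)"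
    by (intro add_mono sum_mono) (use ab ab' in \<open>auto intro!: sq4 sq1 simp: abs_minus_commute\<close>)
  also have "\<dots> = (\<Sum>e\<in>?N. case e of (u, v) \<Rightarrow> (D u - D v)\<^sup>2)"
    using fN L by (intro sum.subset_diff[symmetric]) auto
  also have "\<dots> = (\<Sum>(u, v)\<in>A. (D u - D v)\<^sup>2)"
    using finite_A by (intro sum.mono_neutral_left) auto
  finally have "int (card (?N - ?L)) + 16 \<le> (\<Sum>(u, v)\<in>A. (D u - D v)\<^sup>2)"
    using L4 by simp
  then show ?thesis using cN card_nonzero_arcs by linarith
qed

section \<open>Steep edges where the outside is attached to the cycle\<close>

context
  fixes m c assumes iso: "isocycle m c"
begin

text \<open>Take for \<open>a\<close> the vertex at which a shortest path from \<open>p\<close> to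
  \<open>w\<close> first leaves the cycle.\<close>

lemma iso_attach_via:
  assumes "p \<in> range c" "w \<in> V - range c"
  obtains a b where "a \<in> range c" "b \<in> V - range c" "(a, b) \<in> A" "d p w = d p a + d a w"
proof -
  have "\<exists>a\<in>range c. \<exists>b\<in>V - range c. (a, b) \<in> A \<and> d p w = d p a + d a w"
    using assms(1)
  proof (induction "nat (d p w)" arbitrary: p rule: less_induct)
    case less
    have p: "p \<in> V" "p \<noteq> w" "w \<in> V" using less.prems assms(2) iso_subset[OF iso] by auto
    obtain q where q: "(p, q) \<in> A" "d p w = d q w + 1" using d_closer[OF p(1,3,2)] .
    show ?case
    proof (cases "q \<in> range c")
      case True
      then obtain a b where ab: "a \<in> range c" "b \<in> V - range c" "(a, b) \<in> A" "d q w = d q a + d a w"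
        using less.hyps[of q] q d_nonneg[of q w] by auto
      have "d p a \<le> d q a + 1" "d p w \<le> d p a + d a w"
        using d_adj_le[OF q(1)] d_triangle p ab iso_subset[OF iso] by auto
      then have "d p w = d p a + d a w" using q ab by simp
      then show ?thesis using ab by blast
    next
      case False
      then show ?thesis using q less.prems A_V[OF q(1)] by (intro bexI[of _ p] bexI[of _ q]) auto
    qed
  qed
  then show ?thesis using that by blast
qed

text \<open>Every outside vertex is reached through \<open>c i\<close>, so on both cycle edges at
  \<open>c i\<close> the value of \<open>D\<close> changes by the number of outside
  vertices.\<close>

lemma steep_one_attach:
  assumes att: "\<And>a b. a \<in> range c \<Longrightarrow> b \<in> V - range c \<Longrightarrow> (a, b) \<in> A \<Longrightarrow> a = c i"
    and card: "2 \<le> card (V - range c)"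
  shows "2 * int (card V) + 2 < (\<Sum>(u, v)\<in>A. (D u - D v)\<^sup>2)"
proof -
  have "D p - D (c i) = int (card (V - range c))" if p: "p \<in> range c" "d p (c i) = 1" for p
  proof -
    obtain k where k: "p = c k" using p by auto
    have "d p w - d (c i) w = 1" if w: "w \<in> V - range c" for w
    proof -
      obtain a b where "a \<in> range c" "b \<in> V - range c" "(a, b) \<in> A" "d p w = d p a + d a w"
        using iso_attach_via[OF p(1) w] .
      then show ?thesis using att p by auto
    qed
    then have "(\<Sum>w\<in>V - range c. d p w - d (c i) w) = int (card (V - range c))" by simp
    then show ?thesis using iso_D_diff[OF iso, of k i] k by simp
  qed
  from this[of "c (i + 1)"] this[of "c (i - 1)"]
  have "2 \<le> \<bar>D (c i) - D (c (i + 1))\<bar>" "2 \<le> \<bar>D (c i) - D (c (i - 1))\<bar>"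
    using card iso_adj[OF iso, of i] d_adj[OF A_sym] by auto
  moreover have "{c i, c (i + 1)} \<noteq> {c i, c (i - 1)}"
    using iso_neq[OF iso, of "i + 1" "i - 1"] iso_m[OF iso] by (auto simp: doubleton_eq_iff)
  ultimately show ?thesis using sum_sq_if_steep iso_adj[OF iso, of i] by blast
qed

end

text \<open>The cycle is rotated so that one attachment vertex has index 0. The bounds on
  \<open>l\<close> keep the two attachment vertices distinct, while \<open>r = r'\<close> may
  happen.\<close>

definition two_attach :: "int \<Rightarrow> (int \<Rightarrow> 'a) \<Rightarrow> int \<Rightarrow> 'a \<Rightarrow> 'a \<Rightarrow> bool" where
  "two_attach m c l r r' \<longleftrightarrow> isocycle m c \<and> 1 \<le> l \<and> l \<le> m - 1 \<and>
     A \<inter> range c \<times> (V - range c) = {(c 0, r), (c l, r')}"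

text \<open>Together with \<open>two_attach_flip\<close> this carries statements about the edge from
  \<open>c 0\<close> to \<open>c 1\<close> over to all four cycle edges at attachment
  vertices.\<close>

lemma two_attach_swap:
  assumes "two_attach m c l r r'"
  shows "two_attach m (\<lambda>i. c (l - i)) l r' r"
  using assms isocycle_reflect[of m c l] by (auto simp: two_attach_def range_reflect)

lemma two_attach_flip:
  assumes "two_attach m c l r r'"
  shows "two_attach m (\<lambda>i. c (- i)) (m - l) r r'"
proof -
  have "isocycle m c" using assms by (simp add: two_attach_def)
  then have "c (l - m) = c l" by (simp add: iso_eq_iff)
  then show ?thesis using assms isocycle_reflect[of m c 0] range_reflect[of c 0]
    by (auto simp: two_attach_def)
qed

context
  fixes m c l r r' assumes att: "two_attach m c l r r'"
begin

lemma att_iso: "isocycle m c" and att_l: "1 \<le> l" "l \<le> m - 1"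
  and att_eq: "A \<inter> range c \<times> (V - range c) = {(c 0, r), (c l, r')}"
  using att by (auto simp: two_attach_def)

lemma att_V: "c i \<in> V"
  using att_iso by (rule iso_V)

lemma att_rest: "r \<in> V - range c" "r' \<in> V - range c" "(c 0, r) \<in> A" "(c l, r') \<in> A"
  using att_eq by auto

lemma att_only: "(a, b) \<in> A \<Longrightarrow> a \<in> range c \<Longrightarrow> b \<in> V - range c \<Longrightarrow>
    a = c 0 \<and> b = r \<or> a = c l \<and> b = r'"
  using att_eq by auto

lemma att_neq: "c 0 \<noteq> c l"
  using iso_neq[OF att_iso, of 0 l] att_l by auto

lemma att_deg_2:
  assumes "v \<in> V - {c 0, c l}"
  shows "card (A `` {v}) = 2"
proof (rule deg_eq_2_if_two_branch[OF att_V att_V att_neq _ _ assms])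
  have "3 \<le> card (A `` {c i})" if "(c i, s) \<in> A" "s \<in> V - range c" for i s
  proof -
    have "card (insert s (A `` {c i} \<inter> range c)) = 3"
      using that finite_A iso_nbrs_card[OF att_iso, of i] by (subst card_insert_disjoint) auto
    then show ?thesis using that finite_A card_mono[of "A `` {c i}" "insert s (A `` {c i} \<inter> range c)"] by auto
  qed
  then show "3 \<le> card (A `` {c 0})" "3 \<le> card (A `` {c l})" using att_rest by blast+
qed

text \<open>A vertex \<open>w\<close> outside the cycle is farther from \<open>c 1\<close> than from \<open>c 0\<close>, equally far, or closer,
  according to how \<open>gap w\<close> compares with the distance from \<open>c 1\<close> to \<open>c l\<close>.\<close>

abbreviation (input) gap :: "'a \<Rightarrow> int" where
  "gap w \<equiv> d (c 0) w - d (c l) w"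

text \<open>A shortest path from \<open>c 1\<close> to an outside vertex leaves the cycle at
  \<open>c 0\<close> or at \<open>c l\<close>, whichever is cheaper.\<close>

lemma att_D_diff: "D (c 1) - D (c 0) = (\<Sum>w\<in>V - range c. min 1 (cyc m (l - 1) - gap w))"
proof -
  have "d (c 1) w - d (c 0) w = min 1 (cyc m (l - 1) - gap w)" if w: "w \<in> V - range c" for w
  proof -
    have d: "d (c 1) (c 0) = 1" "d (c 1) (c l) = cyc m (l - 1)"
      using d_adj[OF A_sym[OF iso_adj(1)[OF att_iso, of 0]]] iso_d[OF att_iso, of 1 l] cyc_diff_commute[of m 1 l]
      by auto
    have "d (c 1) w \<le> 1 + d (c 0) w" "d (c 1) w \<le> cyc m (l - 1) + d (c l) w"
      using d_triangle[of "c 1" _ w] att_V w d by (metis DiffD1)+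
    moreover obtain a b where "a \<in> range c" "b \<in> V - range c" "(a, b) \<in> A" "d (c 1) w = d (c 1) a + d a w"
      using iso_attach_via[OF att_iso rangeI w] .
    then have "d (c 1) w = 1 + d (c 0) w \<or> d (c 1) w = cyc m (l - 1) + d (c l) w"
      using att_only d by fastforce
    ultimately show ?thesis by auto
  qed
  then show ?thesis using iso_D_diff[OF att_iso, of 1 0] by simp
qed

lemma att_gap:
  assumes "w \<in> V"
  shows "\<bar>gap w\<bar> \<le> cyc m l"
proof -
  have "d (c 0) (c l) = cyc m l" "d (c l) (c 0) = cyc m l"
    using iso_d[OF att_iso, of 0 l] iso_d[OF att_iso, of l 0] by (auto simp: cyc_uminus)
  then show ?thesis
    using d_triangle[OF att_V att_V assms, of 0 l] d_triangle[OF att_V att_V assms, of l 0] by auto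
qed

lemma att_cyc: "m \<le> 2 * l \<Longrightarrow> cyc m l = m - l" "cyc m (l - 1) = min (l - 1) (m - l + 1)"
  using att_l by (auto simp: cyc_abs)

lemma att_gap_adj: "(u, v) \<in> A \<Longrightarrow> \<bar>gap u - gap v\<bar> \<le> 2"
  using d_adj_le[of u v "c 0"] d_adj_le[of u v "c l"] d_adj_le[of v u "c 0"] d_adj_le[of v u "c l"]
    A_sym[of u v] A_V[of u v] att_V d_commute[of _ "c 0"] d_commute[of _ "c l"] by auto

lemma att_gap_r: "gap r \<le> 0" "0 \<le> gap r'"
proof -
  have "d (c i) s \<ge> 1" if "s \<in> V - range c" for i s
    using that d_eq_0_iff[of "c i" s] d_nonneg[of "c i" s] att_V by (metis DiffE int_one_le_iff_zero_less le_less rangeI)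
  from this[OF att_rest(1), of l] this[OF att_rest(2), of 0]
  show "gap r \<le> 0" "0 \<le> gap r'" using d_adj[OF att_rest(3)] d_adj[OF att_rest(4)] by auto
qed

lemma att_nbr:
  assumes "K \<subseteq> V - range c" "K \<noteq> {}" "card K < card (V - range c)"
  shows "\<exists>u\<in>K. \<exists>v\<in>V - range c - K. (u, v) \<in> A"
  using iso_rest_boundary[OF att_iso assms(1,2)] assms(3) by blast

text \<open>Here \<open>c 1\<close> lies on the longer arc between \<open>c 0\<close> and
  \<open>c l\<close>. If the arc lengths \<open>l\<close> and \<open>m - l\<close> differ by at
  least 2, then \<open>c 1\<close> is farther than \<open>c 0\<close> from every outside vertex. If
  they differ by 1, it is never nearer, and it is farther from \<open>r\<close> and from at least
  one other outside vertex.\<close>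

lemma att_end_steep:
  assumes l: "m + 1 \<le> 2 * l" and R: "2 \<le> card (V - range c)" and n: "7 \<le> card V"
  shows "2 \<le> D (c 1) - D (c 0)"
proof (cases "m + 2 \<le> 2 * l")
  case True
  have "min 1 (cyc m (l - 1) - gap w) = 1" if "w \<in> V - range c" for w
    using att_gap[of w] att_cyc that True by auto
  then have "D (c 1) - D (c 0) = int (card (V - range c))" unfolding att_D_diff by simp
  then show ?thesis using R by simp
next
  case False
  then have m: "m = 2 * l - 1" using l by simp
  have l2: "2 \<le> l" using m iso_m[OF att_iso] by simp
  let ?R = "V - range c" and ?t = "\<lambda>w. min 1 (cyc m (l - 1) - gap w)"
  have cyc: "cyc m (l - 1) = l - 1" "cyc m l = l - 1" using att_cyc m by auto
  have t0: "0 \<le> ?t w" if "w \<in> ?R" for w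
    using att_gap[of w] that cyc by auto
  \<comment> \<open>Otherwise \<open>gap\<close> is at least \<open>l - 1\<close> at all outside
    vertices but \<open>r\<close>. Since it is at most 1 at an outside neighbour of
    \<open>r\<close>, this leaves only \<open>l = 2\<close> with \<open>r'\<close> as that
    neighbour.\<close>
  have "\<exists>w\<in>?R. w \<noteq> r \<and> gap w < l - 1"
  proof (rule ccontr)
    assume "\<not> ?thesis"
    then have big: "l - 1 \<le> gap w" if "w \<in> ?R" "w \<noteq> r" for w using that by force
    have r_nbr: "l = 2 \<and> w = r'" if w: "w \<in> ?R" "w \<noteq> r" "(r, w) \<in> A" for w
    proof -
      have "d (c 0) w \<le> 2" using d_triangle[of "c 0" r w] d_adj w att_rest att_V by fastforce
      moreover have "d (c l) w \<ge> 1"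
        using w d_eq_0_iff[of "c l" w] d_nonneg[of "c l" w] att_V by (metis DiffE int_one_le_iff_zero_less le_less rangeI)
      ultimately have "l = 2" "d (c l) w = 1" using big[OF w(1,2)] l2 by auto
      then have "(c l, w) \<in> A" using d_eq_1D att_V w by auto
      from att_only[OF this] have "w = r'" using w att_neq by auto
      then show ?thesis using \<open>l = 2\<close> by simp
    qed
    obtain w where w: "w \<in> ?R" "w \<noteq> r" "(r, w) \<in> A"
      using att_nbr[of "{r}"] R att_rest by auto
    have rr': "l = 2" "(r, r') \<in> A" "r' \<noteq> r" using r_nbr[OF w] w by auto
    have "card (A `` {r'}) = 2" using att_rest(2) by (intro att_deg_2) auto
    moreover have "{r, c l} \<subseteq> A `` {r'}" using rr' att_rest A_sym by auto
    moreover have "r \<noteq> c l" using att_rest by blast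
    then have "card {r, c l} = 2" by simp
    ultimately have nb': "A `` {r'} = {r, c l}" using finite_A by (metis card_subset_eq finite_Image)
    \<comment> \<open>The cycle is a triangle and \<open>card V\<close> is at least 7, so there are
      more outside vertices, but neither \<open>r\<close> nor \<open>r'\<close> has a neighbour
      among them.\<close>
    have "int (card ?R) \<ge> 4" using card_V_iso[OF att_iso] n m rr' by simp
    then obtain u v where "u \<in> {r, r'}" "v \<in> ?R - {r, r'}" "(u, v) \<in> A"
      using att_nbr[of "{r, r'}"] att_rest rr' by force
    then show False using r_nbr[of v] nb' by auto
  qed
  then obtain w where w: "w \<in> ?R" "w \<noteq> r" "gap w < l - 1" by auto
  have "(\<Sum>x\<in>{r, w}. ?t x) \<le> (\<Sum>x\<in>?R. ?t x)"
    using w att_rest t0 finite_V by (intro sum_mono2) auto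
  moreover have "?t r = 1" "?t w = 1" using att_gap_r l2 cyc w by auto
  ultimately show ?thesis unfolding att_D_diff using w by simp
qed

text \<open>For antipodal attachment vertices one end alone need not be steep, but \<open>gap\<close> passes through
  the middle of its range, which makes the two ends steep together.\<close>

lemma att_sum_steep:
  assumes m: "m = 2 * l" and l: "3 \<le> l" and R: "2 \<le> card (V - range c)"
  shows "3 \<le> (\<Sum>w\<in>V - range c. min 1 (cyc m (l - 1) - gap w) +
    min 1 (cyc m (l - 1) - (d (c l) w - d (c 0) w)))"
    (is "3 \<le> (\<Sum>w\<in>?R. ?t w)")
proof -
  have cyc: "cyc m (l - 1) = l - 1" "cyc m l = l" using att_cyc m by auto
  have t0: "0 \<le> ?t w" if "w \<in> ?R" for w
    using att_gap[of w] that l unfolding cyc by auto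
  have t1: "1 \<le> ?t w" if "w \<in> ?R" "\<bar>gap w\<bar> \<le> 2" for w
    using that(2) l unfolding cyc by linarith
  have t2: "2 \<le> ?t w" if "w \<in> ?R" "\<bar>gap w\<bar> \<le> 1" for w
    using that(2) l unfolding cyc by linarith
  \<comment> \<open>Along an edge \<open>gap\<close> changes by at most 2. From \<open>r\<close> to
    \<open>r'\<close> it passes from nonpositive to nonnegative, so it takes the value 0 or jumps
    from -1 to 1. Then \<open>u\<close> contributes 2 and \<open>v\<close> at least 1.\<close>
  have "\<exists>u\<in>?R. \<exists>v\<in>?R. (u, v) \<in> A \<and> \<bar>gap u\<bar> \<le> 1 \<and> \<bar>gap v\<bar> \<le> 2"
  proof (cases "\<exists>u\<in>?R. gap u = 0")
    case True
    then obtain u where u: "u \<in> ?R" "gap u = 0" by auto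
    obtain v where "v \<in> ?R" "(u, v) \<in> A" using att_nbr[of "{u}"] R u by auto
    then show ?thesis using u att_gap_adj[of u v] by (intro bexI[of _ u] bexI[of _ v]) auto
  next
    case False
    let ?K = "{w \<in> ?R. gap w < 0}"
    have "r \<in> ?K" "r' \<in> ?R - ?K" using False att_gap_r att_rest by force+
    then obtain u v where "u \<in> ?K" "v \<in> ?R - ?K" "(u, v) \<in> A"
      using iso_rest_boundary[OF att_iso, of ?K] by blast
    moreover from this have "gap u < 0" "gap v > 0" using False by force+
    ultimately show ?thesis using att_gap_adj[of u v]  by (intro bexI[of _ u] bexI[of _ v]) auto
  qed
  then obtain u v where uv: "u \<in> ?R" "v \<in> ?R" "(u, v) \<in> A" "\<bar>gap u\<bar> \<le> 1" "\<bar>gap v\<bar> \<le> 2" by blast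
  have "u \<noteq> v" using uv A_irrefl by auto
  have "(\<Sum>x\<in>{u, v}. ?t x) \<le> (\<Sum>x\<in>?R. ?t x)"
    using uv t0 finite_V by (intro sum_mono2) auto
  then show ?thesis using t2[OF uv(1,4)] t1[OF uv(2,5)] \<open>u \<noteq> v\<close> by simp
qed

end

text \<open>If the arcs differ in length, the longer one has a steep edge at each end. If they are
  equal, the two ends together reach 3, so one of them reaches 2, and there the two cycle edges are
  steep by reflection.\<close>

lemma steep_two_attach:
  assumes att: "two_attach m c l r r'" and l: "m \<le> 2 * l"
    and R: "2 \<le> card (V - range c)" and n: "7 \<le> card V" and exc: "\<not> (m = 4 \<and> l = 2)"
  shows "2 * int (card V) + 2 < (\<Sum>(u, v)\<in>A. (D u - D v)\<^sup>2)"
proof -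
  note iso = att_iso[OF att]
  note swap = two_attach_swap[OF att]
  have m3: "3 \<le> m" using iso_m[OF iso] .
  have adj: "(c i, c (i + 1)) \<in> A" "(c i, c (i - 1)) \<in> A" for i using iso_adj[OF iso] .
  show ?thesis
  proof (cases "m + 1 \<le> 2 * l")
    case True
    have "2 \<le> D (c 1) - D (c 0)" using att_end_steep[OF att True R n] .
    moreover have "2 \<le> D (c (l - 1)) - D (c l)"
      using att_end_steep[OF swap True] R n by (simp add: range_reflect)
    moreover have "{c 0, c 1} \<noteq> {c l, c (l - 1)}"
      using att_neq[OF att] iso_neq[OF iso, of 0 "l - 1"] att_l[OF att] True m3
      by (auto simp: doubleton_eq_iff)
    ultimately show ?thesis
      using sum_sq_if_steep[of "c 0" "c 1" "c l" "c (l - 1)"] adj(1)[of 0] adj(2)[of l] by auto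
  next
    case False
    then have m: "m = 2 * l" using l by simp
    have "l \<noteq> 2" using m exc by auto
    then have l3: "3 \<le> l" using m m3 by linarith
    \<comment> \<open>For \<open>m = 2 * l\<close> reversing the cycle keeps \<open>l\<close>, so
      both cycle edges at an attachment vertex have the same difference.\<close>
    have flip: "D (c (- 1)) - D (c 0) = D (c 1) - D (c 0)" if "two_attach m c l r r'" for c r r'
    proof -
      have "m dvd - l - l" using m by (intro dvdI[of _ _ "- 1"]) simp
      then have cl: "c (- l) = c l" using iso_eq_iff[OF att_iso[OF that]] by blast
      show ?thesis
        using att_D_diff[OF two_attach_flip[OF that]] att_D_diff[OF that] m range_reflect[of c 0] cl by simp
    qed
    have "3 \<le> (D (c 1) - D (c 0)) + (D (c (l - 1)) - D (c l))"
      using att_sum_steep[OF att m l3 R] att_D_diff[OF att] att_D_diff[OF swap]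
      by (simp add: range_reflect sum.distrib)
    then consider "2 \<le> D (c 1) - D (c 0)" | "2 \<le> D (c (l - 1)) - D (c l)" by linarith
    then show ?thesis
    proof cases
      case 1
      have "c 1 \<noteq> c (- 1)" by (rule iso_neq[OF iso]) (use m3 in auto)
      then have ne: "{c 0, c 1} \<noteq> {c 0, c (- 1)}" by (auto simp: doubleton_eq_iff)
      show ?thesis
        by (rule sum_sq_if_steep[OF _ _ _ _ ne]) (use adj[of 0] 1 flip[OF att] in auto)
    next
      case 2
      have "c (l - 1) \<noteq> c (l + 1)" by (rule iso_neq[OF iso]) (use m3 in auto)
      then have ne: "{c l, c (l - 1)} \<noteq> {c l, c (l + 1)}" by (auto simp: doubleton_eq_iff)
      show ?thesis
        by (rule sum_sq_if_steep[OF _ _ _ _ ne]) (use adj[of l] 2 flip[OF swap] in auto)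
    qed
  qed
qed

text \<open>At most two arcs leave the cycle. If they start at different vertices, rotation moves
  one of these to index 0 and a flip, if necessary, ensures \<open>m \<le> 2 * l\<close>.\<close>

lemma steep_isocycle:
  assumes iso: "isocycle m c" and R: "2 \<le> card (V - range c)" and n: "7 \<le> card V"
  shows "2 * int (card V) + 2 < (\<Sum>(u, v)\<in>A. (D u - D v)\<^sup>2) \<or>
    m = 4 \<and> (\<exists>c r r'. two_attach 4 c 2 r r' \<and> 2 \<le> card (V - range c))"
proof -
  let ?X = "A \<inter> range c \<times> (V - range c)"
  have "range c \<noteq> {}" "range c \<noteq> V" using iso_rest_nonempty[OF iso] by auto
  then obtain a b where ab0: "a \<in> range c" "b \<in> V - range c" "(a, b) \<in> A"
    using A_boundary[OF iso_subset[OF iso]] by metis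
  then have ab: "(a, b) \<in> ?X" by auto
  obtain i where i: "a = c i" using ab0 by auto
  show ?thesis
  proof (cases "\<forall>(a', b')\<in>?X. a' = a")
    case True
    then show ?thesis using steep_one_attach[OF iso _ R, of i] i by fast
  next
    case False
    then obtain a' b' where ab': "(a', b') \<in> ?X" "a' \<noteq> a" by auto
    have X: "?X = {(a, b), (a', b')}"
    proof (rule sym, rule card_seteq)
      show "card ?X \<le> card {(a, b), (a', b')}" using iso_attach_card[OF iso] ab' by auto
    qed (use ab ab' finite_A in auto)
    obtain k where k: "i \<le> k" "k < i + m" "c k = a'" using iso_index[OF iso] ab'(1) by (metis IntD2 SigmaD1 rangeE)
    define l where "l = k - i"
    have l: "1 \<le> l" "l \<le> m - 1" using k ab' i by (auto simp: l_def le_less)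
    have att: "two_attach m (\<lambda>j. c (j + i)) l b b'"
      unfolding two_attach_def range_shift using isocycle_shift[OF iso] l X i k by (auto simp: l_def)
    have r1: "range (\<lambda>j. c (j + i)) = range c" by (rule range_shift)
    have r2: "range (\<lambda>j. c (- j + i)) = range c"
      using range_reflect[of c i] by simp
    show ?thesis
    proof (cases "m = 4 \<and> l = 2")
      case True
      then show ?thesis using att R r1 by metis
    next
      case exc: False
      show ?thesis
      proof (cases "m \<le> 2 * l")
        case True
        then show ?thesis using steep_two_attach[OF att True] R n exc r1 by simp
      next
        case False
        then show ?thesis using steep_two_attach[OF two_attach_flip[OF att]] R n exc r2 by simp
      qed
    qed
  qed
qed

section \<open>Choice of the isometric cycle\<close>

lemma card_rest_ge: "isocycle m c \<Longrightarrow> 1 \<le> card (V - range c)"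
  using iso_rest_nonempty finite_V by (simp add: Suc_le_eq card_gt_0_iff)

lemma triangle_isocycle:
  assumes "(x, y) \<in> A" "(y, z) \<in> A" "(z, x) \<in> A"
  obtains c where "isocycle 3 c" "range c = {x, y, z}"
proof
  let ?c = "\<lambda>i::int. if i mod 3 = 0 then x else if i mod 3 = 1 then y else z"
  have m3: "i mod 3 = 0 \<or> i mod 3 = 1 \<or> i mod 3 = 2" for i :: int
    using pos_mod_bound[of 3 i] pos_mod_sign[of 3 i] by presburger
  have cyc: "cyc 3 i = (if i mod 3 = 0 then 0 else 1)" for i
  proof -
    have "cyc 3 (i mod 3) = (if i mod 3 = 0 then 0 else 1)"
      using m3[of i] by (auto simp: cyc_abs)
    then show ?thesis by (simp add: cyc_mod)
  qed
  have "d (?c i) (?c j) = (if i mod 3 = j mod 3 then 0 else 1)" for i j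
    using m3[of i] m3[of j] d_adj[OF assms(1)] d_adj[OF assms(2)] d_adj[OF assms(3)]
      d_adj[OF A_sym[OF assms(1)]] d_adj[OF A_sym[OF assms(2)]] d_adj[OF A_sym[OF assms(3)]]
    by (elim disjE) simp_all
  moreover have "(i - j) mod 3 = 0 \<longleftrightarrow> i mod 3 = j mod 3" for i j :: int
    by (simp add: mod_eq_dvd_iff dvd_eq_mod_eq_0)
  ultimately show "isocycle 3 ?c"
    using assms A_V by (auto simp: isocycle_def cyc)
  have "x = ?c 0" "y = ?c 1" "z = ?c 2" by auto
  then have "{x, y, z} \<subseteq> range ?c" by blast
  then show "range ?c = {x, y, z}" by auto
qed

text \<open>The only outside vertex \<open>z\<close> has two neighbours, both on the cycle and at
  distance 1 or 2 from each other. Distance 1 gives a triangle with at least four vertices outside,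
  so \<open>steep_isocycle\<close> applies; distance 2 makes \<open>z\<close> a twin of the cycle
  vertex between them.\<close>

lemma steep_or_twin_cycle:
  assumes iso: "isocycle m c" and R: "card (V - range c) = 1" and n: "7 \<le> card V"
  shows "2 * int (card V) + 2 < (\<Sum>(u, v)\<in>A. (D u - D v)\<^sup>2) \<or> (\<exists>c z. twin_cycle m c z)"
proof -
  obtain z where z: "V - range c = {z}" using R by (auto simp: card_1_singleton_iff)
  have zV: "z \<in> V" "z \<notin> range c" "V = insert z (range c)" using z iso_subset[OF iso] by auto
  have nb_C: "A `` {z} \<subseteq> range c"
  proof
    fix x assume "x \<in> A `` {z}"
    then have "x \<in> V" "x \<noteq> z" using A_V A_irrefl by auto
    then show "x \<in> range c" using zV(3) by blast
  qed
  have "card (A `` {z}) \<le> 2"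
  proof -
    have "(\<lambda>a. (a, z)) ` (A `` {z}) \<subseteq> A \<inter> range c \<times> (V - range c)"
      using nb_C zV A_sym by auto
    then have "card ((\<lambda>a. (a, z)) ` (A `` {z})) \<le> 2"
      using iso_attach_card[OF iso] finite_A card_mono by (metis (no_types, lifting) finite_Int order_trans)
    then show ?thesis by (subst (asm) card_image) (auto intro: inj_onI)
  qed
  then have "card (A `` {z}) = 2" using deg_ge_2[OF zV(1)] by simp
  then obtain a a' where a: "A `` {z} = {a, a'}" "a \<noteq> a'" by (auto simp: card_2_iff)
  have za: "(z, a) \<in> A" "(z, a') \<in> A" using a by auto
  have aV: "a \<in> V" "a' \<in> V" using za A_V by auto
  have "d a a' \<noteq> 0" using d_eq_0_iff aV a by auto
  moreover have "d a a' \<le> 2" using d_triangle[OF aV(1) zV(1) aV(2)] d_adj[OF za(2)] d_adj[OF A_sym[OF za(1)]] by simp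
  ultimately consider "d a a' = 1" | "d a a' = 2" using d_nonneg[of a a'] by linarith
  then show ?thesis
  proof cases
    case 1
    then have "(a, a') \<in> A" using d_eq_1D aV by auto
    then obtain c' where c': "isocycle 3 c'" using triangle_isocycle[OF za(1) _ A_sym[OF za(2)]] by metis
    moreover have "2 \<le> card (V - range c')" using card_V_iso[OF c'] n by linarith
    ultimately show ?thesis using steep_isocycle[OF c' _ n] by simp
  next
    case 2
    obtain i where i: "a = c i" using nb_C a by auto
    obtain j where j: "i \<le> j" "j < i + m" "c j = a'" using iso_index[OF iso] nb_C a by (metis insertCI rangeE subsetD)
    have m3: "3 \<le> m" using iso_m[OF iso] .
    have "min (j - i) (m - (j - i)) = 2" using 2 iso_d_abs[OF iso, of i j] i j by auto
    then consider "j = i + 2" | "j = i + m - 2" by (auto simp: min_def split: if_splits)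
    then have "\<exists>k. A `` {z} = {c (k + 1), c (k - 1)}"
    proof cases
      case 1
      then have "c (i + 1 + 1) = a'" "c (i + 1 - 1) = a" using i j by (auto simp: add.commute)
      then show ?thesis using a by (metis insert_commute)
    next
      case 2
      have "c (i - 1 - 1) = c j" using 2 iso_eq_iff[OF iso, of "i - 1 - 1" j] by simp
      then have "c (i - 1 - 1) = a'" "c (i - 1 + 1) = a" using i j by auto
      then show ?thesis using a by metis
    qed
    then obtain k where "A `` {z} = {c (k + 1), c (k - 1)}" ..
    then have "A `` {z} = {c (1 + k), c (- 1 + k)}" by (simp add: add.commute)
    then have "twin_cycle m (\<lambda>i. c (i + k)) z"
      unfolding twin_cycle_def range_shift using zV(2,3) isocycle_shift[OF iso, of k] by blast
    then show ?thesis by blast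
  qed
qed

text \<open>In the exceptional case the cycle has length 4 and its two free vertices are twins; the cycle
  through one of them and all of \<open>G - C\<close> misses only the other one.\<close>

lemma isocycle_card_rest_1:
  assumes att: "two_attach 4 c 2 r r'" and R: "2 \<le> card (V - range c)"
  obtains m c' where "isocycle m c'" "card (V - range c') = 1"
proof -
  let ?R = "V - range c"
  note iso = att_iso[OF att]
  have cV: "c i \<in> V" for i using att_V[OF att] .
  have deg: "card (A `` {v}) = 2" if "v \<in> V" "v \<noteq> c 0" "v \<noteq> c 2" for v
    using att_deg_2[OF att] that by auto
  have fR: "finite ?R" using finite_V by simp
  \<comment> \<open>Although chosen outside the cycle, \<open>s\<close> is farthest from
    \<open>c 0\<close> in the whole graph: the vertices of a 4-cycle stay within distance 2, and an
    outside vertex other than \<open>r\<close> is at distance at least 2.\<close>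
  obtain s where s: "s \<in> ?R" "\<And>w. w \<in> ?R \<Longrightarrow> d (c 0) w \<le> d (c 0) s"
    using finite_arg_max_int[OF fR iso_rest_nonempty[OF iso]] by blast
  have "\<not> ?R \<subseteq> {r}" using R card_mono[of "{r}" ?R] by auto
  then obtain w where w: "w \<in> ?R" "w \<noteq> r" by blast
  have "d (c 0) w \<noteq> 0" using w d_eq_0_iff cV by auto
  moreover have "d (c 0) w \<noteq> 1"
    using att_only[OF att, of "c 0" w] att_neq[OF att] d_eq_1D[of "c 0" w] w cV by auto
  ultimately have s2: "2 \<le> d (c 0) s" using s(2)[OF w(1)] d_nonneg[of "c 0" w] by linarith
  have far: "d (c 0) v \<le> d (c 0) s" if "v \<in> V" for v
  proof (cases "v \<in> range c")
    case True
    then obtain i where "v = c i" by auto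
    moreover obtain k where "0 \<le> k" "k < 0 + 4" "c k = c i" using iso_index[OF iso] by blast
    ultimately show ?thesis using iso_d_abs[OF iso, of 0 k] s2 by auto
  qed (use s that in auto)
  have "card (A `` {s}) = 2" using deg s by auto
  then obtain u u' where nb: "A `` {s} = {u, u'}" "u \<noteq> u'" by (auto simp: card_2_iff)
  have "s \<noteq> c 0" using s by auto
  then obtain m c' where iso': "isocycle m c'" "s \<in> range c'"
    using isocycle_through_farthest[OF nb cV _ far] by metis
  \<comment> \<open>An isometric cycle contains both neighbours of each of its vertices of degree 2.
    As \<open>G - C\<close> is connected and its vertices have degree 2, the new cycle absorbs all
    of it, and then \<open>c 0\<close> and \<open>c 2\<close> through \<open>r\<close> and
    \<open>r'\<close>.\<close>
  have closed: "A `` {v} \<subseteq> range c'" if v: "v \<in> range c'" "v \<noteq> c 0" "v \<noteq> c 2" for v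
  proof -
    obtain i where "v = c' i" using v(1) by blast
    then show ?thesis using iso_deg2[OF iso'(1), of i] deg[of v] v iso_subset[OF iso'(1)] by auto
  qed
  have closedR: "A `` {v} \<subseteq> range c'" if "v \<in> range c'" "v \<in> ?R" for v
    using closed that by auto
  have "?R \<inter> range c' = ?R"
  proof (rule ccontr)
    assume ne: "?R \<inter> range c' \<noteq> ?R"
    have "?R \<inter> range c' \<noteq> {}" using s iso' by auto
    then obtain a b where "a \<in> ?R \<inter> range c'" "b \<in> ?R - ?R \<inter> range c'" "(a, b) \<in> A"
      using iso_rest_boundary[OF iso _ _ ne] by blast
    then show False using closedR[of a] by auto
  qed
  then have R_sub: "?R \<subseteq> range c'" by auto
  have c02: "c 0 \<in> range c'" "c 2 \<in> range c'"
    using closedR[of r] closedR[of r'] att_rest[OF att] A_sym R_sub by blast+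
  have C: "range c = {c 0, c 1, c 2, c 3}"
  proof -
    have "range c = c ` {0..<0 + 4}" using iso_bij[OF iso, of 0] by (simp add: bij_betw_def)
    moreover have "{0..<0 + 4} = {0, 1, 2, 3::int}" by auto
    ultimately show ?thesis by auto
  qed
  let ?R' = "V - range c'"
  have R': "?R' \<subseteq> {c 1, c 3}" using C R_sub c02 by auto
  have "(c 1, c 3) \<notin> A" 
    using iso_d_abs[OF iso, of 1 3] d_adj[of "c 1" "c 3"] by auto
  then have nadj: "(c 1, c 3) \<notin> A" "(c 3, c 1) \<notin> A" using A_sym by auto
  \<comment> \<open>The vertices missed by an isometric cycle induce a connected graph, but
    \<open>c 1\<close> and \<open>c 3\<close> are not adjacent.\<close>
  have "?R' \<noteq> {c 1, c 3}"
  proof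
    assume eq: "?R' = {c 1, c 3}"
    have "c 1 \<noteq> c 3" using iso_neq[OF iso, of 1 3] by simp
    then have K: "{c 1} \<subseteq> ?R'" "{c 1} \<noteq> {}" "{c 1} \<noteq> ?R'" unfolding eq by auto
    obtain a b where "a \<in> {c 1}" "b \<in> ?R' - {c 1}" "(a, b) \<in> A"
      using iso_rest_boundary[OF iso'(1) K] .
    then show False using nadj eq by auto
  qed
  moreover have "S = {a} \<or> S = {b}" if "S \<subseteq> {a, b}" "S \<noteq> {}" "S \<noteq> {a, b}" for S and a b :: 'a
    using that by blast
  ultimately have "?R' = {c 1} \<or> ?R' = {c 3}" using R' iso_rest_nonempty[OF iso'(1)] by metis
  then have "card ?R' = 1" by (elim disjE) simp_all
  then show ?thesis using that iso'(1) by blast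
qed

text \<open>Let \<open>v\<close> be farthest from a vertex \<open>x\<close> of degree at least 3. If
  \<open>v\<close> or another farthest vertex has degree 2, an isometric cycle passes through it.
  Otherwise \<open>v\<close> is the only farthest vertex and all vertices but \<open>x\<close> and
  \<open>v\<close> have degree 2; then one passes through a neighbour \<open>z1\<close> of
  \<open>v\<close>.\<close>

lemma ex_isocycle:
  obtains m c where "isocycle m c"
proof -
  note result = that
  have "\<exists>x\<in>V. 3 \<le> card (A `` {x})"
  proof (rule ccontr)
    assume "\<not> ?thesis"
    then have "card (A `` {v}) = 2" if "v \<in> V" for v using deg_ge_2[OF that] that by force
    then show False using card_A card_A_eq by simp
  qed
  then obtain x where x: "x \<in> V" "3 \<le> card (A `` {x})" by auto
  obtain v where v: "v \<in> V" "\<And>w. w \<in> V \<Longrightarrow> d x w \<le> d x v"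
    using finite_arg_max_int[OF finite_V, of "d x"] x(1) by blast
  have far2: thesis if w: "w \<in> V" "d x w = d x v" "w \<noteq> x" "card (A `` {w}) = 2" for w
  proof -
    obtain u u' where nb: "A `` {w} = {u, u'}" "u \<noteq> u'" using w by (auto simp: card_2_iff)
    show thesis
      by (rule isocycle_through_farthest[OF nb x(1)]) (use w v result in auto)
  qed
  obtain w where w: "(x, w) \<in> A"
  proof -
    have "A `` {x} \<noteq> {}" using x by auto
    then show ?thesis using that by auto
  qed
  then have "v \<noteq> x" using v(2)[of w] d_adj[OF w] A_V[OF w] by auto
  show thesis
  proof (cases "card (A `` {v}) = 2")
    case True
    then show thesis using far2[of v] v \<open>v \<noteq> x\<close> by simp
  next
    case False
    then have v3: "3 \<le> card (A `` {v})" using deg_ge_2[OF v(1)] by simp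
    have deg: "card (A `` {w}) = 2" if "w \<in> V" "w \<noteq> x" "w \<noteq> v" for w
      using deg_eq_2_if_two_branch[OF x(1) v(1) _ x(2) v3] \<open>v \<noteq> x\<close> that by auto
    show thesis
    proof (cases "\<exists>w\<in>V. w \<noteq> v \<and> d x w = d x v")
      case True
      then obtain w where w: "w \<in> V" "w \<noteq> v" "d x w = d x v" by auto
      have "w \<noteq> x" using w \<open>v \<noteq> x\<close> d_eq_0_iff[OF x(1) v(1)] by auto
      then show thesis using far2[of w] deg[of w] w by simp
    next
      case False
      then have less: "d x w < d x v" if "w \<in> V" "w \<noteq> v" for w
        using v(2)[OF that(1)] that by force
      have "\<exists>z1 z2. z1 \<in> A `` {v} - {x} \<and> z2 \<in> A `` {v} - {x} \<and> z1 \<noteq> z2"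
      proof (rule ccontr)
        assume "\<not> ?thesis"
        then have "card (A `` {v} - {x}) \<le> 1"
          using finite_A by (intro card_le_Suc0_iff_eq[THEN iffD2, simplified One_nat_def[symmetric]]) auto
        moreover have "card (A `` {v}) \<le> card (A `` {v} - {x}) + 1"
          using finite_A by (metis add.commute card_Diff1_le card_Suc_Diff1 finite_Image Diff_empty Diff_insert0 le_add2 order_refl plus_1_eq_Suc)
        ultimately show False using v3 by simp
      qed
      then obtain z1 z2 where z: "(v, z1) \<in> A" "(v, z2) \<in> A" "z1 \<noteq> x" "z2 \<noteq> x" "z1 \<noteq> z2" by auto
      have zV: "z1 \<in> V" "z2 \<in> V" "z1 \<noteq> v" "z2 \<noteq> v" using z A_V A_irrefl by auto
      obtain u u' where nb: "A `` {z1} = {u, u'}" "u \<noteq> u'"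
        using deg[of z1] zV z by (auto simp: card_2_iff)
      \<comment> \<open>So \<open>z1\<close> is not nearer to \<open>x\<close> than any vertex but
        \<open>v\<close>. Hence only \<open>v\<close> could have to descend through
        \<open>z1\<close>, and it can use \<open>z2\<close> instead.\<close>
      have d1: "d x v \<le> d x z1 + 1"
        using d_adj_le[OF z(1) x(1)] d_commute x v zV by simp
      show thesis
      proof (rule isocycle_through_if_descent[OF nb x(1)])
        fix w assume w: "w \<in> V" "w \<noteq> z1" "w \<noteq> x"
        show "\<exists>w'. (w, w') \<in> A \<and> w' \<noteq> z1 \<and> d x w' < d x w"
        proof (cases "w = v")
          case True
          then show ?thesis using z zV less by blast
        next
          case False
          obtain w' where w': "(w, w') \<in> A" "d w x = d w' x + 1" using d_closer[OF w(1) x(1) w(3)] .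
          then have "d x w = d x w' + 1" using d_commute x w A_V by metis
          then show ?thesis using w' less[OF w(1) False] d1 by force
        qed
      qed (use z result in auto)
    qed
  qed
qed

lemma steep_or_twin:
  assumes n: "7 \<le> card V"
  shows "2 * int (card V) + 2 < (\<Sum>(u, v)\<in>A. (D u - D v)\<^sup>2) \<or> (\<exists>m c z. twin_cycle m c z)"
proof -
  have one: ?thesis if "isocycle m c" "card (V - range c) = 1" for m c
    using steep_or_twin_cycle[OF that n] by blast
  obtain m c where iso: "isocycle m c" by (rule ex_isocycle)
  show ?thesis
  proof (cases "card (V - range c) = 1")
    case True
    then show ?thesis using one iso by blast
  next
    case False
    then have "2 \<le> card (V - range c)" using card_rest_ge[OF iso] by simp
    from steep_isocycle[OF iso this n] show ?thesis
      using isocycle_card_rest_1 one by metis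
  qed
qed

end

section \<open>The revised Szeged index\<close>

lemma digraph_iso_with_projI:
  assumes "pair_wf_digraph G" "inj_on f (pverts G)" "f ` pverts G = pverts H" "map_prod f f ` parcs G = parcs H"
  shows "digraph_iso (with_proj G) (with_proj H)"
proof -
  interpret pair_wf_digraph G by fact
  have "inj_on (map_prod f f) (parcs G)"
    by (rule inj_on_subset[OF map_prod_inj_on[OF assms(2) assms(2)]]) (use in_arcsD1 in_arcsD2 in auto)
  then have "pre_digraph.digraph_isomorphism (with_proj G)
      \<lparr>iso_verts = f, iso_arcs = map_prod f f, iso_head = snd, iso_tail = fst\<rparr>"
    using assms(2) wf_digraph_axioms by (auto simp: pre_digraph.digraph_isomorphism_def)
  moreover have "with_proj H = app_iso
      \<lparr>iso_verts = f, iso_arcs = map_prod f f, iso_head = snd, iso_tail = fst\<rparr> (with_proj G)"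
    using assms by (simp add: app_iso_def with_proj_def)
  ultimately show ?thesis unfolding digraph_iso_def by blast
qed

lemma connected_graph_pair_graph:
  assumes "pair_graph G" "connected (with_proj G)"
  shows "connected_graph (pverts G) (parcs G)"
proof -
  interpret pair_graph G by fact
  show ?thesis
  proof
    show "finite (pverts G)" by (rule pair_finite_verts)
    show "parcs G \<subseteq> pverts G \<times> pverts G" using in_arcsD1 in_arcsD2 by auto
    show "(v, u) \<in> parcs G" if "(u, v) \<in> parcs G" for u v using that by (rule arcs_symmetric)
    show "(v, v) \<notin> parcs G" for v using pair_no_loops by fastforce
    have "parcs (mk_symmetric (with_proj G)) = parcs G"
      using arcs_symmetric by (auto simp: parcs_mk_symmetric)
    then have "(u, v) \<in> rtrancl_on (pverts G) (parcs G)" if "u \<in> pverts G" "v \<in> pverts G" for u v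
      using assms(2) that by (auto simp: connected_def strongly_connected_def reachable_def)
    then show "(u, v) \<in> (parcs G)\<^sup>*" if "u \<in> pverts G" "v \<in> pverts G" for u v
      using that by (metis rtrancl_on_rtranclI)
  qed
qed

text \<open>With unit costs the cost of a walk is its length, walks of length \<open>k\<close>
  correspond to \<open>parcs G ^^ k\<close>, and a shortest walk attains the infimum.\<close>

lemma gdist_eq:
  assumes "pair_graph G" "connected_graph (pverts G) (parcs G)" and uv: "u \<in> pverts G" "v \<in> pverts G"
  shows "gdist G u v = ereal (real_of_int (connected_graph.d (parcs G) u v))"
proof -
  interpret pair_graph G by fact
  interpret C: connected_graph "pverts G" "parcs G" by fact
  have cost: "awalk_cost (\<lambda>_. 1) p = real (length p)" for p :: "('a \<times> 'a) list"
    by (simp add: awalk_cost_def sum_list_triv)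
  have walk: "(\<exists>p. awalk u p v \<and> length p = k) \<longleftrightarrow> (u, v) \<in> parcs G ^^ k"
    if "u \<in> pverts G" "v \<in> pverts G" for u v k
    using that
  proof (induction k arbitrary: u)
    case 0
    then show ?case by (auto simp: awalk_Nil_iff)
  next
    case (Suc k)
    have "(\<exists>p. awalk u p v \<and> length p = Suc k) \<longleftrightarrow>
        (\<exists>w. (u, w) \<in> parcs G \<and> (\<exists>p. awalk w p v \<and> length p = k))" (is "?L \<longleftrightarrow> ?R")
    proof
      assume ?L
      then obtain e p where "awalk u (e # p) v" "length p = k" by (auto simp: length_Suc_conv)
      then have "(u, snd e) \<in> parcs G" "awalk (snd e) p v" by (auto simp: awalk_Cons_iff)
      then show ?R using \<open>length p = k\<close> by blast
    next
      assume ?R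
      then obtain w p where "(u, w) \<in> parcs G" "awalk w p v" "length p = k" by blast
      then have "awalk u ((u, w) # p) v" "length ((u, w) # p) = Suc k" by (auto simp: awalk_Cons_iff)
      then show ?L by blast
    qed
    also have "\<dots> \<longleftrightarrow> (\<exists>w. (u, w) \<in> parcs G \<and> (w, v) \<in> parcs G ^^ k)"
      using Suc in_arcsD2 by blast
    also have "\<dots> \<longleftrightarrow> (u, v) \<in> parcs G ^^ Suc k"
      by (metis relpow_Suc_D2 relpow_Suc_I2)
    finally show ?case .
  qed
  show ?thesis
    unfolding gdist_def \<mu>_def cost
  proof (rule antisym)
    obtain p where "awalk u p v" "length p = nat (C.d u v)"
      using iffD2[OF walk[OF uv] C.relpow_d[OF uv]] by auto
    then show "(INF p\<in>{p. awalk u p v}. ereal (real (length p))) \<le> ereal (real_of_int (C.d u v))"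
      using C.d_nonneg[of u v] by (intro INF_lower2[of p]) auto
    show "ereal (real_of_int (C.d u v)) \<le> (INF p\<in>{p. awalk u p v}. ereal (real (length p)))"
    proof (rule INF_greatest)
      fix p assume "p \<in> {p. awalk u p v}"
      then have "C.d u v \<le> int (length p)" using iffD1[OF walk[OF uv], of "length p"] C.d_le_relpow by auto
      then show "ereal (real_of_int (C.d u v)) \<le> ereal (real (length p))"
        by (simp add: of_int_le_iff[symmetric] del: of_int_le_iff)
    qed
  qed
qed

lemma sum_arcs_eq_sum_uedges:
  fixes F :: "'a set \<Rightarrow> real"
  assumes "connected_graph (pverts G) (parcs G)"
  shows "(\<Sum>(u, v)\<in>parcs G. F {u, v}) = 2 * (\<Sum>e\<in>uedges G. F e)"
proof -
  interpret C: connected_graph "pverts G" "parcs G" by fact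
  let ?g = "\<lambda>(u, v). {u, v}"
  have "uedges G = ?g ` parcs G" by (auto simp: uedges_def)
  then have "(\<Sum>(u, v)\<in>parcs G. F {u, v}) = (\<Sum>e\<in>uedges G. \<Sum>a\<in>{a\<in>parcs G. ?g a = e}. F (?g a))"
    using sum.image_gen[OF C.finite_A, of "\<lambda>a. F (?g a)" ?g] by (simp add: case_prod_unfold)
  also have "\<dots> = (\<Sum>e\<in>uedges G. 2 * F e)"
  proof (rule sum.cong[OF refl])
    fix e assume "e \<in> uedges G"
    then obtain u v where e: "e = {u, v}" "(u, v) \<in> parcs G" by (auto simp: uedges_def)
    then have "{a\<in>parcs G. ?g a = e} = {(u, v), (v, u)}"
      using C.A_sym by (auto simp: doubleton_eq_iff)
    moreover have "u \<noteq> v" using e C.A_irrefl by auto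
    ultimately show "(\<Sum>a\<in>{a\<in>parcs G. ?g a = e}. F (?g a)) = 2 * F e"
      using e by (simp add: insert_commute)
  qed
  finally show ?thesis by (simp add: sum_distrib_left)
qed

lemma card_arcs_eq_uedges:
  assumes "connected_graph (pverts G) (parcs G)"
  shows "card (parcs G) = 2 * card (uedges G)"
  using sum_arcs_eq_sum_uedges[OF assms, of "\<lambda>_. 1"] by (simp add: case_prod_unfold)

text \<open>The two factors of an edge term have sum \<open>card (pverts G)\<close> and their
  difference is that of \<open>D\<close>, so four times the term is a difference of squares. The
  other factor 2 in the 8 comes from summing over arcs.\<close>

lemma revised_szeged_eq:
  assumes "pair_graph G" "connected_graph (pverts G) (parcs G)"
  defines "D \<equiv> connected_graph.D (pverts G) (parcs G)"
  shows "8 * revised_szeged G = real (card (parcs G)) * (real (card (pverts G)))\<^sup>2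
    - real_of_int (\<Sum>(u, v)\<in>parcs G. (D u - D v)\<^sup>2)"
proof -
  interpret C: connected_graph "pverts G" "parcs G" by fact
  let ?V = "pverts G" and ?F = "\<lambda>e. \<Prod>u\<in>e. real (card (closer G u e)) + real (card (equidistant G e)) / 2"
  have "4 * ?F {u, v} = (real (card ?V))\<^sup>2 - real_of_int ((D u - D v)\<^sup>2)" if uv: "(u, v) \<in> parcs G" for u v
  proof -
    have V: "u \<in> ?V" "v \<in> ?V" "u \<noteq> v" using uv C.A_V C.A_irrefl by auto
    let ?P = "{w \<in> ?V. C.d u w < C.d v w}" and ?Q = "{w \<in> ?V. C.d v w < C.d u w}"
      and ?E = "{w \<in> ?V. C.d u w = C.d v w}"
    have sets: "{w \<in> ?V. gdist G u w < gdist G v w} = ?P" "{w \<in> ?V. gdist G v w < gdist G u w} = ?Q"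
      "{w \<in> ?V. gdist G u w = gdist G v w} = ?E"
      using V by (auto simp: gdist_eq[OF assms(1,2)])
    have "?V = ?P \<union> ?Q \<union> ?E" by auto
    then have "card ?V = card (?P \<union> ?Q \<union> ?E)" by simp
    also have "\<dots> = card ?P + card ?Q + card ?E"
      using C.finite_V by (subst card_Un_disjoint; auto)+
    finally have card: "card ?V = card ?P + card ?Q + card ?E" .
    \<comment> \<open>Distances from adjacent vertices differ by at most 1, so each \<open>w\<close>
      only contributes the sign of the comparison.\<close>
    have "C.d v w - C.d u w = of_bool (C.d u w < C.d v w) - of_bool (C.d v w < C.d u w)" if "w \<in> ?V" for w
      using C.d_adj_le[OF uv that] C.d_adj_le[OF C.A_sym[OF uv] that] by auto
    then have "D v - D u = (\<Sum>w\<in>?V. of_bool (C.d u w < C.d v w) - of_bool (C.d v w < C.d u w))"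
      by (simp add: D_def C.D_def sum_subtractf[symmetric])
    also have "\<dots> = int (card ?P) - int (card ?Q)"
      using C.finite_V by (simp add: sum_subtractf of_bool_def sum.If_cases Int_def)
    finally have diff: "D v - D u = int (card ?P) - int (card ?Q)" .
    have F: "?F {u, v} = (real (card ?P) + real (card ?E) / 2) * (real (card ?Q) + real (card ?E) / 2)"
      using szeged_term_edge[OF V(3), of G] unfolding sets .
    have "real_of_int (D u - D v) = real (card ?Q) - real (card ?P)" using diff by simp
    then have sq: "real_of_int ((D u - D v)\<^sup>2) = (real (card ?Q) - real (card ?P))\<^sup>2" by simp
    have "4 * ((p + e / 2) * (q + e / 2)) = (p + q + e)\<^sup>2 - (q - p)\<^sup>2" for p q e :: real
      by (simp add: power2_eq_square field_simps)
    from this[of "real (card ?P)" "real (card ?E)" "real (card ?Q)"]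
    show ?thesis unfolding F sq card of_nat_add .
  qed
  then have "(\<Sum>(u, v)\<in>parcs G. 4 * ?F {u, v}) =
      (\<Sum>(u, v)\<in>parcs G. (real (card ?V))\<^sup>2 - real_of_int ((D u - D v)\<^sup>2))"
    by (intro sum.cong) auto
  moreover have "8 * revised_szeged G = (\<Sum>(u, v)\<in>parcs G. 4 * ?F {u, v})"
    unfolding revised_szeged_def using sum_arcs_eq_sum_uedges[OF assms(2), of "\<lambda>e. 4 * ?F e"]
    by (simp add: sum_distrib_left[symmetric])
  ultimately show ?thesis by (simp add: case_prod_unfold sum_subtractf)
qed

section \<open>Coordinates for \<open>B_n\<close>\<close>

context
  fixes n :: nat
  assumes n: "n \<ge> 4"
begin

definition B_cycle :: "int \<Rightarrow> nat" where
  "B_cycle i = nat (i mod int (n - 1))"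

lemma B_cycle_less: "B_cycle i < n - 1"
  using n pos_mod_bound[of "int (n - 1)" i] pos_mod_sign[of "int (n - 1)" i]
  by (simp add: B_cycle_def nat_less_iff)

lemma int_B_cycle: "int (B_cycle i) = i mod int (n - 1)"
  using n by (simp add: B_cycle_def)

lemma B_cycle_of_nat: "k < n - 1 \<Longrightarrow> B_cycle (int k) = k"
  by (simp add: B_cycle_def)

lemma B_cycle_Suc: "B_cycle (i + 1) = Suc (B_cycle i) mod (n - 1)"
proof -
  have "int (B_cycle (i + 1)) = int (Suc (B_cycle i) mod (n - 1))"
    by (simp add: int_B_cycle zmod_int mod_simps add.commute)
  then show ?thesis by simp
qed

lemma range_B_cycle: "range B_cycle = {0..<n - 1}"
proof
  show "{0..<n - 1} \<subseteq> range B_cycle"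
  proof
    fix k assume "k \<in> {0..<n - 1}"
    then have "k = B_cycle (int k)" using B_cycle_of_nat by simp
    then show "k \<in> range B_cycle" by blast
  qed
qed (use B_cycle_less in auto)

lemma pverts_B: "pverts (B_graph n) = insert (n - 1) {0..<n - 1}"
  by (simp add: B_graph_def duplicate_vertex_def cycle_graph_def)

lemma parcs_B_cycle: "(B_cycle i, B_cycle (i + 1)) \<in> parcs (B_graph n)"
  using B_cycle_less[of i] B_cycle_less[of "i + 1"]
  by (auto simp: B_graph_def duplicate_vertex_def cycle_graph_def B_cycle_Suc)

lemma B_cycle_neighbours: "B_cycle 1 = 1" "B_cycle (- 1) = n - 2"
proof -
  show "B_cycle 1 = 1" using B_cycle_of_nat[of 1] n by simp
  have "int (B_cycle (- 1)) = int (n - 2)"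
    unfolding int_B_cycle using n by (simp add: zmod_minus1 of_nat_diff)
  then show "B_cycle (- 1) = n - 2" by simp
qed

lemma parcs_B_new: "(n - 1, x) \<in> parcs (B_graph n) \<longleftrightarrow> x = 1 \<or> x = n - 2"
proof -
  have "(n - 1, x) \<in> parcs (B_graph n) \<longleftrightarrow> x < n - 1 \<and> (x = Suc 0 mod (n - 1) \<or> 0 = Suc x mod (n - 1))"
    using n by (auto simp: B_graph_def duplicate_vertex_def cycle_graph_def)
  moreover have "Suc 0 mod (n - 1) = 1" using n by simp
  moreover have "0 = Suc x mod (n - 1) \<longleftrightarrow> x = n - 2" if "x < n - 1"
    using that n by (cases "Suc x = n - 1") auto
  moreover have "1 < n - 1" "n - 2 < n - 1" using n by auto
  ultimately show ?thesis by metis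
qed

lemma parcs_cycle_cases:
  assumes "(x, y) \<in> parcs (cycle_graph (n - 1))"
  obtains i where "B_cycle i = x" "y = B_cycle (i + 1) \<or> y = B_cycle (i - 1)"
proof -
  have lt: "x < n - 1" "y < n - 1" and "y = Suc x mod (n - 1) \<or> x = Suc y mod (n - 1)"
    using assms by (auto simp: cycle_graph_def)
  then consider "y = B_cycle (int x + 1)" | "x = B_cycle (int y + 1)"
    using B_cycle_Suc[of "int x"] B_cycle_Suc[of "int y"] by (auto simp: B_cycle_of_nat)
  then show ?thesis
  proof cases
    case 1
    then show ?thesis using that[of "int x"] lt by (simp add: B_cycle_of_nat)
  next
    case 2
    then show ?thesis using that[of "int y + 1"] lt by (simp add: B_cycle_of_nat)
  qed
qed

text \<open>Folding the new vertex \<open>n - 1\<close> onto its original 0 is a graph homomorphism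
  to the cycle, so it does not increase distances.\<close>

lemma parcs_B_imp_cycle:
  assumes "(x, y) \<in> parcs (B_graph n)"
  shows "(if x = n - 1 then 0 else x, if y = n - 1 then 0 else y) \<in> parcs (cycle_graph (n - 1))"
  using assms n by (auto simp: B_graph_def duplicate_vertex_def cycle_graph_def)

lemma connected_graph_B: "connected_graph (pverts (B_graph n)) (parcs (B_graph n))"
proof -
  interpret pair_graph "B_graph n" using n by (rule pair_graph_B_graph)
  let ?A = "parcs (B_graph n)"
  have sym: "(v, u) \<in> ?A" if "(u, v) \<in> ?A" for u v using that by (rule arcs_symmetric)
  show ?thesis
  proof
    show "finite (pverts (B_graph n))" by (rule pair_finite_verts)
    show "?A \<subseteq> pverts (B_graph n) \<times> pverts (B_graph n)" using in_arcsD1 in_arcsD2 by auto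
    show "(v, u) \<in> ?A" if "(u, v) \<in> ?A" for u v using that by (rule sym)
    show "(v, v) \<notin> ?A" for v using pair_no_loops by fastforce
    have "(B_cycle 0, B_cycle (int k)) \<in> ?A\<^sup>*" for k
    proof (induction k)
      case (Suc k)
      then show ?case using parcs_B_cycle[of "int k"] by (simp add: add.commute)
    qed simp
    then have cyc: "(0, k) \<in> ?A\<^sup>*" if "k < n - 1" for k
      using B_cycle_of_nat[OF that] B_cycle_of_nat[of 0] n by (metis gr_implies_not0 of_nat_0 that zero_less_iff_neq_zero)
    moreover have "(0, n - 1) \<in> ?A\<^sup>*"
    proof (rule rtrancl_into_rtrancl)
      show "(0, 1) \<in> ?A\<^sup>*" using n by (intro cyc) simp
      show "(1, n - 1) \<in> ?A" using sym parcs_B_new by blast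
    qed
    ultimately have all: "(0, k) \<in> ?A\<^sup>*" if "k \<in> pverts (B_graph n)" for k
      using that unfolding pverts_B by auto
    show "(u, v) \<in> ?A\<^sup>*" if "u \<in> pverts (B_graph n)" "v \<in> pverts (B_graph n)" for u v
      using rtrancl_converse_sym[OF sym all[OF that(1)]] all[OF that(2)] by (rule rtrancl_trans)
  qed
qed

lemma twin_cycle_B:
  "connected_graph.twin_cycle (pverts (B_graph n)) (parcs (B_graph n)) (int (n - 1)) B_cycle (n - 1)"
proof -
  interpret connected_graph "pverts (B_graph n)" "parcs (B_graph n)" by (rule connected_graph_B)
  let ?m = "int (n - 1)" and ?p = "\<lambda>x. if x = n - 1 then 0 else x"
  have m: "3 \<le> ?m" using n by simp
  have cycV: "B_cycle i \<in> pverts (B_graph n)" for i using B_cycle_less unfolding pverts_B by auto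
  have cyc_B: "cyc ?m (i - int (B_cycle j)) = cyc ?m (i - j)" for i j
    unfolding int_B_cycle by (metis cyc_mod mod_diff_right_eq)
  have "d (B_cycle i) (B_cycle j) = cyc ?m (i - j)" for i j
  proof (rule antisym)
    show "d (B_cycle i) (B_cycle j) \<le> cyc ?m (i - j)"
      using m by (intro closed_walk_d_le parcs_B_cycle) (auto simp: B_cycle_def)
    \<comment> \<open>The distance on the cycle from position \<open>i\<close> to the folded image
      of \<open>x\<close>. It changes by at most 1 along arcs, so \<open>lipschitz_le_d\<close>
      gives the lower bound.\<close>
    let ?h = "\<lambda>x. cyc ?m (i - int (?p x))"
    have "?h y \<le> ?h x + 1" if xy: "(y, x) \<in> parcs (B_graph n)" for x y
    proof -
      obtain k where k: "B_cycle k = ?p y" "?p x = B_cycle (k + 1) \<or> ?p x = B_cycle (k - 1)"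
        using parcs_cycle_cases[OF parcs_B_imp_cycle[OF xy]] .
      have hB: "cyc ?m (i - int q) = cyc ?m (i - k)" if "B_cycle k = q" for q k
        unfolding that[symmetric] by (rule cyc_B)
      from k(2) consider "B_cycle (k + 1) = ?p x" | "B_cycle (k - 1) = ?p x" by (elim disjE) auto
      then have "?h x = cyc ?m (i - (k + 1)) \<or> ?h x = cyc ?m (i - (k - 1))"
        by cases (use hB in \<open>blast, blast\<close>)
      moreover have "\<bar>cyc ?m (i - k) - cyc ?m (i - (k + 1))\<bar> \<le> 1" "\<bar>cyc ?m (i - (k - 1)) - cyc ?m (i - k)\<bar> \<le> 1"
        using cyc_step_abs[of ?m "i - (k + 1)"] cyc_step_abs[of ?m "i - k"] m by (simp_all add: algebra_simps)
      moreover have "?h y = cyc ?m (i - k)" by (rule hB[OF k(1)])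
      ultimately show ?thesis by linarith
    qed
    then have "?h (B_cycle j) \<le> ?h (B_cycle i) + d (B_cycle j) (B_cycle i)"
      by (rule lipschitz_le_d[OF _ cycV cycV])
    moreover have "?h (B_cycle k) = cyc ?m (i - k)" for k
      using B_cycle_less[of k] cyc_B by simp
    ultimately show "cyc ?m (i - j) \<le> d (B_cycle i) (B_cycle j)"
      using d_commute[OF cycV cycV] by (simp add: cyc_def)
  qed
  then have "isocycle ?m B_cycle" using m cycV by (auto simp: isocycle_def)
  moreover have "parcs (B_graph n) `` {n - 1} = {B_cycle 1, B_cycle (- 1)}"
    unfolding B_cycle_neighbours using parcs_B_new by auto
  ultimately show ?thesis unfolding twin_cycle_def range_B_cycle by (simp add: pverts_B)
qed

end

section \<open>Comparison with \<open>B_n\<close>\<close>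

theorem theorem2p4:
  fixes n :: nat and G :: "'a pair_pre_digraph"
  assumes "n > 6"
    and "pair_graph G"
    and "connected (with_proj G)"
    and "card (pverts G) = n"
    and "card (uedges G) = n + 1"
    and "\<not> digraph_iso (with_proj G) (with_proj (B_graph n))"
  shows "revised_szeged G < revised_szeged (B_graph n)"
proof -
  have n4: "n \<ge> 4" using assms(1) by simp
  interpret G: connected_graph "pverts G" "parcs G"
    using assms(2,3) by (rule connected_graph_pair_graph)
  interpret B: connected_graph "pverts (B_graph n)" "parcs (B_graph n)"
    using n4 by (rule connected_graph_B)
  note twB = twin_cycle_B[OF n4]
  have cA: "card (parcs G) = 2 * n + 2"
    using card_arcs_eq_uedges[OF G.connected_graph_axioms] assms(5) by simp
  have cB: "card (parcs (B_graph n)) = 2 * n + 2"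
    using B.twin_cycle_card(2)[OF twB] n4 by linarith
  let ?S = "\<Sum>(u, v)\<in>parcs G. (G.D u - G.D v)\<^sup>2"
  have large: "2 * int n + 2 < ?S"
  proof (cases "\<exists>v\<in>pverts G. card (parcs G `` {v}) < 2")
    case True
    then obtain v where v: "v \<in> pverts G" "card (parcs G `` {v}) < 2" by auto
    have "{v} \<noteq> pverts G"
    proof
      assume "{v} = pverts G"
      then have "card (pverts G) = card {v}" by simp
      then show False using assms(1,4) by simp
    qed
    then obtain u where u: "(v, u) \<in> parcs G" using G.A_boundary[of "{v}"] v(1) by blast
    have fin: "finite (parcs G `` {v})" using G.finite_A by (rule finite_Image)
    have "card (parcs G `` {v}) \<noteq> 0" using u fin by auto
    then have "card (parcs G `` {v}) = 1" using v by simp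
    then have nb: "parcs G `` {v} = {u}" using u by (metis Image_singleton_iff card_1_singletonE singletonD)
    have "u \<noteq> v" using u G.A_irrefl by auto
    then have "2 * (G.D v - G.D u)\<^sup>2 = (\<Sum>(a, b)\<in>{(v, u), (u, v)}. (G.D a - G.D b)\<^sup>2)"
      by (simp add: power2_commute)
    also have "\<dots> \<le> ?S"
      using u G.A_sym G.finite_A by (intro sum_mono2) auto
    finally have "2 * (int n - 2)\<^sup>2 \<le> ?S" using G.pendant_D_diff[OF v(1) nb] assms(4) by simp
    \<comment> \<open>From \<open>n > 6\<close> one factor \<open>n - 2\<close> is at least
      5.\<close>
    moreover have "10 * (int n - 2) \<le> 2 * (int n - 2)\<^sup>2"
      unfolding power2_eq_square mult.assoc[symmetric] using assms(1) by (intro mult_right_mono) auto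
    ultimately have "10 * (int n - 2) \<le> ?S" by (rule order_trans[rotated])
    moreover have "2 * int n + 2 < 10 * (int n - 2)" using assms(1) by simp
    ultimately show ?thesis by (rule less_le_trans[rotated])
  next
    case False
    interpret bicyclic_graph "pverts G" "parcs G"
      by unfold_locales (use cA assms(4) False in force)+
    show ?thesis
    proof (rule ccontr)
      assume "\<not> ?thesis"
      then obtain m c z where tw: "G.twin_cycle m c z"
        using steep_or_twin assms(1,4) by auto
      then have "m = int (n - 1)" using G.twin_cycle_card(1)[OF tw] assms(1,4) by simp
      then obtain f where f: "inj_on f (pverts G)" "f ` pverts G = pverts (B_graph n)"
          "map_prod f f ` parcs G = parcs (B_graph n)"
        using twin_cycle_iso[OF G.connected_graph_axioms _ B.connected_graph_axioms twB] tw by metis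
      have "pair_wf_digraph G" using assms(2) by (simp add: pair_graph_def pair_digraph_def pair_fin_digraph_def)
      from digraph_iso_with_projI[OF this f] show False using assms(6) by simp
    qed
  qed
  have "(\<Sum>(u, v)\<in>parcs (B_graph n). (B.D u - B.D v)\<^sup>2) \<le> 2 * int n + 2"
    using B.twin_cycle_sum_sq_le[OF twB] card_pverts_B_graph[OF n4] by simp
  then have "real_of_int (\<Sum>(u, v)\<in>parcs (B_graph n). (B.D u - B.D v)\<^sup>2) < real_of_int ?S"
    using large by linarith
  then have "8 * revised_szeged G < 8 * revised_szeged (B_graph n)"
    using revised_szeged_eq[OF assms(2) G.connected_graph_axioms]
      revised_szeged_eq[OF pair_graph_B_graph[OF n4] B.connected_graph_axioms]
      cA cB assms(4) card_pverts_B_graph[OF n4] by simp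
  then show ?thesis by simp
qed

end
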